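(* Let $\gamma\in[0,1]$. In the IID model of the $\gamma$-prophet inequality, the competitive ratio of every algorithm is at most \[ U(\gamma)=1-(1-\gamma)\frac{e^2\log(3-\gamma)-(2-\gamma)}{2(2e^2-1)-(3e^2-1)\gamma}. \] Moreover $U$ is increasing on $[0,1]$, $U(0)=\frac{4-\log 3}{2(2-1/e^2)}\approx0.778$ and $U(1)=1$. Furthermore, there exists a single-threshold algorithm $\textsf{ALG}_\theta$ with $\textsf{CR}^\gamma(\textsf{ALG}_\theta)\ge1-(1-\gamma)p_\gamma$, where $p_\gamma$ is the unique solution $p\in(0,1)$ of $1-(1-\gamma)p=\frac{1-p}{-\log p}$.
   Context: The $\gamma$-prophet inequality ($\gamma\in[0,1]$) in the IID model: an instance is a pair $(F,n)$ with $F$ a known distribution on $[0,\infty)$ with finite expectation; independent values $X_1,\ldots,X_n\sim F$ are revealed one by one. An algorithm is an online stopping rule (decisions depend only on values seen so far and known information) with stopping time $\tau\in\{1,\ldots,n+1\}$; its reward is $\max\{X_\tau,\gamma X_{\tau-1},\ldots,\gamma X_1\}$ (for $\tau=n+1$, $\gamma\max_iX_i$). A single-threshold algorithm with threshold $\theta$ (which may depend on $F$ and $n$) stops at the first value exceeding $\theta$. $\textsf{CR}^\gamma(\textsf{ALG})=\inf_{(F,n)}\mathbb{E}[\text{reward}]/\mathbb{E}[\max_iX_i]$.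
   Formalization: The single-threshold guarantee is proved for atomless F, and for all F if ties at θ are broken at random (it fails for pure thresholds with atoms); p_γ exists uniquely only for γ<1, and at γ=1 the bound CR≥1 uses θ=∞; instances with E[max]=0 are excluded. *)

theory Defs
  imports "HOL-Probability.Probability"
begin

text \<open>
  Step \<open>i\<close> reveals the pair consisting of the value \<open>X\<^sub>i \<sim> F\<close> and an independent uniform coin, which
  is the algorithm's private randomness; a deterministic algorithm ignores the coins.
\<close>

definition step_space :: "real measure \<Rightarrow> (real \<times> real) measure" where
  "step_space F = F \<Otimes>\<^sub>M uniform_measure lborel {0..1}"

definition sample_space :: "real measure \<Rightarrow> nat \<Rightarrow> (nat \<Rightarrow> real \<times> real) measure" where
  "sample_space F n = Pi\<^sub>M {1..n} (\<lambda>_. step_space F)"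

definition val :: "(nat \<Rightarrow> real \<times> real) \<Rightarrow> nat \<Rightarrow> real" where
  "val \<omega> i = fst (\<omega> i)"

definition coin :: "(nat \<Rightarrow> real \<times> real) \<Rightarrow> nat \<Rightarrow> real" where
  "coin \<omega> i = snd (\<omega> i)"

definition max_value :: "nat \<Rightarrow> (nat \<Rightarrow> real) \<Rightarrow> real" where
  "max_value n x = Max (x ` {1..n})"

definition expected_max :: "real measure \<Rightarrow> nat \<Rightarrow> real" where
  "expected_max F n = (\<integral>\<omega>. max_value n (val \<omega>) \<partial>sample_space F n)"

text \<open>
  The condition \<open>expected_max F n > 0\<close> only excludes the point mass at 0, for which the competitive
  ratio would involve \<open>0 / 0\<close> (equal to 0 in HOL).
\<close>

definition iid_instances :: "(real measure \<times> nat) set" where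
  "iid_instances = {(F, n). prob_space F \<and> sets F = sets borel \<and> (AE x in F. 0 \<le> x) \<and>
     integrable F (\<lambda>x. x) \<and> 1 \<le> n \<and> 0 < expected_max F n}"

definition continuous_instances :: "(real measure \<times> nat) set" where
  "continuous_instances = {(F, n) \<in> iid_instances. \<forall>x. measure F {x} = 0}"

text \<open>The information available at time \<open>i\<close>: the sigma-algebra generated by the first \<open>i\<close> steps.\<close>

definition history :: "real measure \<Rightarrow> nat \<Rightarrow> nat \<Rightarrow> (nat \<Rightarrow> real \<times> real) measure" where
  "history F n i = vimage_algebra (space (sample_space F n))
     (\<lambda>\<omega>. restrict \<omega> {1..min i n}) (Pi\<^sub>M {1..min i n} (\<lambda>_. step_space F))"

type_synonym algorithm = "real measure \<Rightarrow> nat \<Rightarrow> (nat \<Rightarrow> real \<times> real) \<Rightarrow> nat"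

definition online_algorithm :: "algorithm \<Rightarrow> bool" where
  "online_algorithm A \<longleftrightarrow> (\<forall>(F, n) \<in> iid_instances.
     (\<forall>\<omega> \<in> space (sample_space F n). A F n \<omega> \<in> {1..n+1}) \<and> stopping_time (history F n) (A F n))"

definition reward :: "real \<Rightarrow> nat \<Rightarrow> (nat \<Rightarrow> real) \<Rightarrow> nat \<Rightarrow> real" where
  "reward \<gamma> n x t = Max ((if t \<le> n then {x t} else {}) \<union> (\<lambda>i. \<gamma> * x i) ` {1..<t})"

definition expected_reward :: "real \<Rightarrow> algorithm \<Rightarrow> real measure \<Rightarrow> nat \<Rightarrow> real" where
  "expected_reward \<gamma> A F n = (\<integral>\<omega>. reward \<gamma> n (val \<omega>) (A F n \<omega>) \<partial>sample_space F n)"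

definition competitive_ratio :: "real \<Rightarrow> (real measure \<times> nat) set \<Rightarrow> algorithm \<Rightarrow> real" where
  "competitive_ratio \<gamma> I A = (INF (F, n) \<in> I. expected_reward \<gamma> A F n / expected_max F n)"

definition first_time :: "nat \<Rightarrow> (nat \<Rightarrow> bool) \<Rightarrow> nat" where
  "first_time n P = (LEAST i. i = n + 1 \<or> (i \<in> {1..n} \<and> P i))"

text \<open>Thresholds are extended reals; the threshold \<open>\<infinity>\<close> means never stopping.\<close>

definition single_threshold :: "(real measure \<Rightarrow> nat \<Rightarrow> ereal) \<Rightarrow> algorithm" where
  "single_threshold \<theta> F n \<omega> = first_time n (\<lambda>i. \<theta> F n < ereal (val \<omega> i))"

text \<open>
  The same rule with stochastic tie-breaking, as needed for distributions with atoms: a value equal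
  to the threshold is accepted with probability \<open>r F n\<close>.  Without it the guarantee fails already for
  \<open>\<gamma> = 0\<close>: let the values be \<open>n\<close> with probability \<open>1/n\<^sup>2\<close> and 1 otherwise; then no threshold has
  ratio above \<open>1/2\<close> in the limit, whereas the guarantee is \<open>1 - 1/e\<close>.
\<close>

definition single_threshold_tie ::
  "(real measure \<Rightarrow> nat \<Rightarrow> ereal) \<Rightarrow> (real measure \<Rightarrow> nat \<Rightarrow> real) \<Rightarrow> algorithm" where
  "single_threshold_tie \<theta> r F n \<omega> = first_time n (\<lambda>i. \<theta> F n < ereal (val \<omega> i) \<or>
     (\<theta> F n = ereal (val \<omega> i) \<and> coin \<omega> i < r F n))"

definition U :: "real \<Rightarrow> real" where
  "U \<gamma> = 1 - (1 - \<gamma>) * ((exp 2 * ln (3 - \<gamma>) - (2 - \<gamma>)) /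
            (2 * (2 * exp 2 - 1) - (3 * exp 2 - 1) * \<gamma>))"

definition is_p_gamma :: "real \<Rightarrow> real \<Rightarrow> bool" where
  "is_p_gamma \<gamma> p \<longleftrightarrow> 0 < p \<and> p < 1 \<and> 1 - (1 - \<gamma>) * p = (1 - p) / (- ln p)"

text \<open>
  For \<open>\<gamma> = 1\<close> the equation has no solution in \<open>(0,1)\<close>; there \<open>p_gamma\<close> is unspecified, but
  \<open>1 - (1 - \<gamma>) * p_gamma \<gamma>\<close> is 1 regardless.
\<close>

definition p_gamma :: "real \<Rightarrow> real" where
  "p_gamma \<gamma> = (THE p. is_p_gamma \<gamma> p)"

end

theory Submission
  imports Defs "HOL-Real_Asymp.Real_Asymp"
begin

text \<open>
  Upper bound: let each of the \<open>n\<close> values be \<open>0\<close> with probability \<open>exp (-2/n)\<close>, otherwise the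
  jackpot \<open>n\<close> with probability of order \<open>1/n\<close>, and \<open>1\<close> in the remaining cases. As \<open>n\<close> grows, the
  unit values form a Poisson process of rate 2 on the time interval \<open>[0,1]\<close>, and the jackpot
  contributes \<open>w = 2 (1 - \<gamma>) / (2 - \<gamma>)\<close> to the expected maximum, which tends to \<open>1 - exp (-2) + w\<close>.
  With time \<open>s\<close> left, let \<open>W\<close> and \<open>V\<close> be the optimal values when a unit value has or has not been
  seen: \<open>W' = w + 2 max 0 (1 - W)\<close> with \<open>W 0 = \<gamma>\<close>, and \<open>V' = w + 2 (max 1 W - V)\<close> with \<open>V 0 = 0\<close>.
  The explicit solutions turn out to be potentials for the finite problem as well, without any
  error term, so every algorithm earns at most \<open>V 1\<close>, and \<open>U \<gamma> = V 1 / (1 - exp (-2) + w)\<close>.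

  Lower bound: choose the threshold \<open>\<theta>\<close> so that no value is accepted with probability exactly \<open>p\<close>,
  and put \<open>D = E max 0 (X - \<theta>)\<close>, \<open>M\<close> = the part of \<open>E max\<close> from the event that nothing is accepted, and
  \<open>q = p powr (1/n)\<close>. The reward is at least \<open>\<gamma> M + (1 - p) \<theta> + (1 - p) / (1 - q) D\<close>, while
  \<open>E max \<le> M + (1 - p) \<theta> + n D\<close> and \<open>M \<le> p \<theta>\<close>. As \<open>n (1 - q) \<le> - ln p\<close>, the equation for \<open>p\<close> makes
  both the \<open>\<theta>\<close>-part and the \<open>D\<close>-part of the ratio at least \<open>1 - (1 - \<gamma>) p\<close>.
\<close>

section \<open>The functions \<open>U\<close> and \<open>p_gamma\<close>\<close>

text \<open>Multiplied by \<open>- ln p\<close>, the equation becomes \<open>f p = 0\<close>. As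
  \<open>f'\<close> is strictly increasing, \<open>f\<close> has at most two zeros on the positive
  axis, and \<open>1\<close> is one of them. Since \<open>f\<close> is negative just left of
  \<open>1\<close> and positive at \<open>exp (-3)\<close>, the other zero lies between these
  points.\<close>

lemma exists_unique_p_gamma:
  fixes \<gamma> :: real
  assumes "0 \<le> \<gamma>" "\<gamma> < 1"
  shows "\<exists>!p. is_p_gamma \<gamma> p"
proof -
  define f where "f p = ((1 - \<gamma>) * p - 1) * ln p - 1 + p" for p :: real
  define f' where "f' p = (1 - \<gamma>) * ln p + (1 - \<gamma>) - 1 / p + 1" for p :: real
  have is_p_iff: "is_p_gamma \<gamma> p \<longleftrightarrow> 0 < p \<and> p < 1 \<and> f p = 0" for p
  proof -
    have "1 - (1 - \<gamma>) * p = (1 - p) / (- ln p) \<longleftrightarrow> f p = 0" if "0 < p" "p < 1"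
    proof -
      have "- ln p \<noteq> 0" using that by simp
      then show ?thesis unfolding f_def
        by (subst eq_divide_eq) (auto simp: algebra_simps)
    qed
    then show ?thesis unfolding is_p_gamma_def by blast
  qed
  have deriv: "(f has_real_derivative f' p) (at p)" if "0 < p" for p
  proof -
    have "(f has_real_derivative (1 - \<gamma>) * ln p + ((1 - \<gamma>) * p - 1) * (1 / p) + 1) (at p)"
      unfolding f_def using that by (auto intro!: derivative_eq_intros)
    moreover have "(1 - \<gamma>) * ln p + ((1 - \<gamma>) * p - 1) * (1 / p) + 1 = f' p"
      unfolding f'_def using that by (simp add: field_simps)
    ultimately show ?thesis by simp
  qed
  have f'_strict_mono: "f' p < f' q" if "0 < p" "p < q" for p q
  proof -
    have "1 / q < 1 / p" using that by (simp add: field_simps)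
    moreover have "(1 - \<gamma>) * ln p < (1 - \<gamma>) * ln q"
      using that assms by (intro mult_strict_left_mono) auto
    moreover have "f' q - f' p = ((1 - \<gamma>) * ln q - (1 - \<gamma>) * ln p) + (1 / p - 1 / q)"
      unfolding f'_def by (simp only: algebra_simps)
    ultimately show ?thesis by linarith
  qed
  have f_1: "f 1 = 0" unfolding f_def by simp
  have rolle: "\<exists>z>p. z < q \<and> f' z = 0" if "0 < p" "p < q" "f p = f q" for p q
  proof -
    have "\<exists>z>p. z < q \<and> f q - f p = (q - p) * f' z"
      using that by (intro MVT2 deriv) auto
    then show ?thesis using that by auto
  qed
  have "\<exists>p. 0 < p \<and> p < 1 \<and> f p = 0"
  proof -
    have "0 < f' 1" using assms by (simp add: f'_def)
    from DERIV_pos_inc_left[OF deriv this] obtain d where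
      d: "0 < d" "\<And>h. 0 < h \<Longrightarrow> h < d \<Longrightarrow> f (1 - h) < f 1" by (metis zero_less_one)
    \<comment> \<open>The cap \<open>1/4\<close> on \<open>e\<close> keeps \<open>1 - e\<close> to
      the right of \<open>b < 1/4\<close>, so that the interval for the intermediate value theorem
      is not empty.\<close>
    define e where "e = min d (1/2) / 2"
    have e: "0 < e" "e < d" "e \<le> 1/4" using d by (auto simp: e_def)
    have neg: "f (1 - e) < 0" using d(2)[OF e(1,2)] f_1 by simp
    \<comment> \<open>With \<open>ln b = -3\<close>,
      \<open>f b = 2 - 3 * (1 - \<gamma>) * b + b\<close> is at least
      \<open>2 - 2 * b\<close>.\<close>
    define b where "b = exp (- 3 :: real)"
    have b: "0 < b" "b < 1/4"
    proof -
      have "4 < exp (3::real)" using exp_ge_add_one_self[of 3] exp_lower_Taylor_quadratic[of 3]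
        by (simp add: power2_eq_square)
      then show "b < 1/4" unfolding b_def exp_minus by (simp add: field_simps)
    qed (simp add: b_def)
    have "(1 - \<gamma>) * b \<le> 1 * b" using b assms by (intro mult_right_mono) auto
    moreover have "f b = 2 - 3 * ((1 - \<gamma>) * b) + b"
      by (simp add: f_def b_def algebra_simps)
    ultimately have pos: "0 < f b" using b by linarith
    have "continuous_on {b..1 - e} f"
      using b by (intro DERIV_continuous_on[where D=f'] DERIV_subset[OF deriv]) auto
    then have "\<exists>x\<ge>b. x \<le> 1 - e \<and> f x = 0"
      using neg pos b e by (intro IVT2'[of f "1 - e" 0 b]) auto
    then obtain x where "b \<le> x" "x \<le> 1 - e" "f x = 0" by blast
    then show ?thesis using b e by (intro exI[of _ x]) auto
  qed
  moreover have "p = q" if "0 < p" "p < 1" "f p = 0" "0 < q" "q < 1" "f q = 0" for p q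
  proof -
    \<comment> \<open>Rolle between \<open>p\<close> and \<open>q\<close> and between
      \<open>q\<close> and the zero \<open>1\<close> yields two zeros of \<open>f'\<close>, against
      its strict monotonicity.\<close>
    have False if pq: "0 < p" "p < q" "q < 1" "f p = 0" "f q = 0" for p q
    proof -
      obtain y where y: "p < y" "y < q" "f' y = 0" using rolle[of p q] pq by auto
      obtain z where z: "q < z" "z < 1" "f' z = 0" using rolle[of q 1] pq f_1 by auto
      show False using f'_strict_mono[of y z] y z \<open>0 < p\<close> by auto
    qed
    then show ?thesis using that by (metis linorder_cases)
  qed
  ultimately show ?thesis unfolding is_p_iff by blast
qed

text \<open>In terms of \<open>x = 1 - \<gamma>\<close>, the loss \<open>1 - U\<close> is
  \<open>N x * (x / D x)\<close>, a product of two nonnegative factors that both strictly increase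
  in \<open>x\<close>.\<close>

lemma strict_mono_on_U: "strict_mono_on {0..1} U"
proof -
  define N where "N x = exp 2 * ln (2 + x) - 1 - x" for x :: real
  define D where "D x = exp 2 - 1 + (3 * exp 2 - 1) * x" for x :: real
  have e2: "exp 2 > (3::real)" using exp_lower_Taylor_quadratic[of 2] by simp
  have U_eq: "U \<gamma> = 1 - N (1 - \<gamma>) * ((1 - \<gamma>) / D (1 - \<gamma>))" for \<gamma>
  proof -
    have "D (1 - \<gamma>) = 2 * (2 * exp 2 - 1) - (3 * exp 2 - 1) * \<gamma>"
      by (simp add: D_def algebra_simps)
    moreover have "N (1 - \<gamma>) = exp 2 * ln (3 - \<gamma>) - (2 - \<gamma>)" by (simp add: N_def algebra_simps)
    ultimately show ?thesis unfolding U_def by simp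
  qed
  have N_mono: "N x < N y" if "0 \<le> x" "x < y" "y \<le> 1" for x y
  proof (rule DERIV_pos_imp_increasing_open[OF \<open>x < y\<close>])
    fix z assume z: "x < z" "z < y"
    have "(N has_real_derivative exp 2 / (2 + z) - 1) (at z)"
      unfolding N_def using z that by (auto intro!: derivative_eq_intros)
    moreover have "exp 2 / (2 + z) - 1 > 0" using z that e2 by (simp add: field_simps)
    ultimately show "\<exists>d. (N has_real_derivative d) (at z) \<and> 0 < d" by blast
  next
    show "continuous_on {x..y} N" unfolding N_def using that by (auto intro!: continuous_intros)
  qed
  have "0 < N 0"
  proof -
    have "3 * (1/2) \<le> exp 2 * ln (2::real)"
      using e2 ln2_ge_two_thirds by (intro mult_mono) auto
    then show ?thesis by (simp add: N_def)
  qed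
  then have N_pos: "0 < N x" if "0 \<le> x" "x \<le> 1" for x
    using N_mono[of 0 x] that by (cases "x = 0") auto
  have D_pos: "0 < D x" if "0 \<le> x" for x
    using e2 that unfolding D_def by (intro add_pos_nonneg mult_nonneg_nonneg) auto
  \<comment> \<open>The quotient grows because the constant term \<open>exp 2 - 1\<close> of the
    affine function \<open>D\<close> is positive.\<close>
  have quot_mono: "x / D x < y / D y" if "0 \<le> x" "x < y" for x y
  proof -
    have "0 < (exp 2 - 1) * (y - x)" using e2 that by simp
    also have "\<dots> = y * D x - x * D y" by (simp add: D_def algebra_simps)
    finally show ?thesis using D_pos[of x] D_pos[of y] that by (simp add: divide_simps mult.commute)
  qed
  show ?thesis
  proof (rule strict_mono_onI)
    fix r s :: real assume rs: "r \<in> {0..1}" "s \<in> {0..1}" "r < s"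
    have "N (1 - s) * ((1 - s) / D (1 - s)) < N (1 - r) * ((1 - r) / D (1 - r))"
      using rs by (intro mult_strict_mono N_mono quot_mono N_pos divide_nonneg_pos D_pos) auto
    then show "U r < U s" by (simp add: U_eq)
  qed
qed

lemma U_0: "U 0 = (4 - ln 3) / (2 * (2 - 1 / exp 2))"
proof -
  have e2: "exp 2 > (3::real)" using exp_lower_Taylor_quadratic[of 2] by simp
  then have "2 - 1 / exp (2::real) \<noteq> 0" "2 * exp 2 - 1 \<noteq> (0::real)" by (auto simp: field_simps)
  then show ?thesis unfolding U_def by (simp add: divide_simps) (simp add: algebra_simps)
qed

lemma U_0_approx: "\<bar>U 0 - 0.778\<bar> < 0.0005"
proof -
  have ln3: "ln 3 \<in> {1.098..1.099::real}"
    using ln_approx_bounds[of 3 6] by (simp add: eval_nat_numeral)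
  have e: "exp 1 \<in> {2.718..2.7183::real}"
    using e_approx_32 unfolding abs_le_iff by simp
  \<comment> \<open>Bounds for \<open>exp 2\<close> come from squaring bounds for
    \<open>exp 1\<close>.\<close>
  have "exp 2 = exp 1 * exp (1::real)" by (simp flip: exp_add)
  moreover have "2.718 * 2.718 \<le> exp 1 * exp (1::real)" using e by (intro mult_mono) auto
  moreover have "exp 1 * exp (1::real) \<le> 2.7183 * 2.7183" using e by (intro mult_mono) auto
  ultimately have e2: "exp 2 \<in> {7.387..7.39::real}" by simp
  have "1 / 7.39 \<le> 1 / exp (2::real)" "1 / exp (2::real) \<le> 1 / 7.387"
    using e2 by (intro divide_left_mono; simp)+
  then have d: "2 - 1 / exp (2::real) \<in> {1.8646..1.8647}" by simp
  have "0.7775 * (2 * (2 - 1 / exp (2::real))) < 4 - ln 3" using d ln3 by simp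
  moreover have "4 - ln 3 < 0.7785 * (2 * (2 - 1 / exp (2::real)))" using d ln3 by simp
  moreover have "0 < 2 * (2 - 1 / exp (2::real))" using d by simp
  ultimately have "0.7775 < U 0" "U 0 < 0.7785" unfolding U_0
    by (simp_all only: pos_less_divide_eq pos_divide_less_eq)
  then show ?thesis unfolding abs_less_iff by simp
qed

section \<open>The sample space\<close>

lemma prob_space_coin: "prob_space (uniform_measure lborel {0..1::real})"
  by (rule prob_space_uniform_measure) auto

locale iid_sample = prob_space F for F :: "real measure" +
  fixes n :: nat
  assumes sets_F [measurable_cong]: "sets F = sets borel"
begin

sublocale step: prob_space "step_space F"
proof -
  interpret C: prob_space "uniform_measure lborel {0..1::real}" by (rule prob_space_coin)
  interpret pair_prob_space F "uniform_measure lborel {0..1::real}" ..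
  show "prob_space (step_space F)" unfolding step_space_def by (rule prob_space_axioms)
qed

sublocale steps: product_prob_space "\<lambda>_::nat. step_space F" "{1..n}" ..

sublocale sample: prob_space "sample_space F n"
  unfolding sample_space_def by (rule prob_space_PiM) (rule step.prob_space_axioms)

lemma space_step [simp]: "space (step_space F) = UNIV"
  using sets_eq_imp_space_eq[OF sets_F] by (simp add: step_space_def space_pair_measure)

lemma sets_step [measurable_cong]: "sets (step_space F) = sets (borel \<Otimes>\<^sub>M borel)"
  unfolding step_space_def by (intro sets_pair_measure_cong) (auto simp: sets_F)

lemma space_sample: "space (sample_space F n) = (\<Pi>\<^sub>E i\<in>{1..n}. UNIV)"
  by (simp add: sample_space_def space_PiM)

lemma distr_fst_step: "distr (step_space F) borel fst = F"
proof -
  interpret C: prob_space "uniform_measure lborel {0..1::real}" by (rule prob_space_coin)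
  interpret pair_prob_space F "uniform_measure lborel {0..1::real}" ..
  have "distr (step_space F) borel fst = distr (F \<Otimes>\<^sub>M uniform_measure lborel {0..1::real}) F fst"
    unfolding step_space_def by (intro distr_cong refl) (auto simp: sets_F)
  also have "\<dots> = F" using C.distr_pair_fst[of F] by simp
  finally show ?thesis .
qed

lemma measurable_component [measurable]:
  "i \<in> {1..n} \<Longrightarrow> (\<lambda>\<omega>. \<omega> i) \<in> sample_space F n \<rightarrow>\<^sub>M step_space F"
  unfolding sample_space_def by (rule measurable_component_singleton)

lemma measurable_fst_step [measurable]: "fst \<in> borel_measurable (step_space F)"
  and measurable_snd_step [measurable]: "snd \<in> borel_measurable (step_space F)"
  by (simp_all add: measurable_cong_sets[OF sets_step refl])

lemma measurable_val [measurable]: "(\<lambda>\<omega>. val \<omega> i) \<in> borel_measurable (sample_space F n)"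
proof (cases "i \<in> {1..n}")
  case True
  then show ?thesis unfolding val_def
    by (intro measurable_compose[OF measurable_component measurable_fst_step])
next
  case False
  \<comment> \<open>Points of the product space are extensional, so a coordinate outside
    \<open>{1..n}\<close> is the constant \<open>undefined\<close>.\<close>
  then have "val \<omega> i = fst (undefined :: real \<times> real)" if "\<omega> \<in> space (sample_space F n)" for \<omega>
    using that by (auto simp: val_def space_sample PiE_def extensional_def)
  then show ?thesis by (subst measurable_cong) auto
qed

section \<open>Histories and stopping times\<close>

lemma space_history [simp]: "space (history F n i) = space (sample_space F n)"
  by (simp add: history_def)

lemma measurable_restrict_history:
  "(\<lambda>\<omega>. restrict \<omega> {1..min i n}) \<in> sample_space F n \<rightarrow>\<^sub>M Pi\<^sub>M {1..min i n} (\<lambda>_. step_space F)"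
  unfolding sample_space_def by (rule measurable_restrict_subset) auto

lemma sets_history_subset: "sets (history F n i) \<subseteq> sets (sample_space F n)"
  unfolding history_def
  by (rule sets_image_in_sets) (auto intro: measurable_restrict_history)

lemma measurable_reward:
  assumes T: "T \<in> sample_space F n \<rightarrow>\<^sub>M count_space UNIV"
  shows "(\<lambda>\<omega>. reward \<gamma> n (val \<omega>) (T \<omega>)) \<in> borel_measurable (sample_space F n)"
\<comment> \<open>\<open>T\<close> has countably many values, so it suffices to treat a fixed time
  \<open>t\<close>.\<close>
proof (rule measurable_compose_countable[OF _ T])
  fix t
  define I where "I = (if t \<le> n then {t} else {}) \<union> {1..<t}"
  have "reward \<gamma> n x t = Max ((\<lambda>i. if i = t then x i else \<gamma> * x i) ` I)" for x
    unfolding reward_def I_def by (intro arg_cong[where f=Max]) auto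
  then show "(\<lambda>\<omega>. reward \<gamma> n (val \<omega>) t) \<in> borel_measurable (sample_space F n)"
    by (simp only: I_def) measurable
qed

lemma measurable_stopping_time_history:
  assumes "stopping_time (history F n) T"
  shows "T \<in> sample_space F n \<rightarrow>\<^sub>M count_space UNIV"
proof -
  have "T \<in> borel_measurable (sample_space F n)"
    by (rule measurable_stopping_time[OF assms]) (auto simp: sets_history_subset)
  then show ?thesis using measurable_cong_sets[OF refl sets_borel_eq_count_space] by blast
qed

text \<open>An event of the history is a preimage under restriction to the first coordinates. This
  turns the sigma-algebra condition into the pointwise fact that a decision ignores the future,
  which the potential argument uses.\<close>

lemma stopping_time_history_cong:
  assumes T: "stopping_time (history F n) T"
    and \<omega>: "\<omega> \<in> space (sample_space F n)" "\<omega>' \<in> space (sample_space F n)"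
    and eq: "\<And>j. j \<in> {1..t} \<Longrightarrow> \<omega> j = \<omega>' j"
  shows "T \<omega> \<le> t \<longleftrightarrow> T \<omega>' \<le> t"
proof -
  have "Measurable.pred (history F n t) (\<lambda>\<omega>. T \<omega> \<le> t)" by (rule stopping_timeD[OF T])
  then have "{\<omega> \<in> space (sample_space F n). T \<omega> \<le> t} \<in> sets (history F n t)"
    by (simp add: pred_def)
  also have "\<dots> = {(\<lambda>\<omega>. restrict \<omega> {1..min t n}) -` A \<inter> space (sample_space F n) | A.
      A \<in> sets (Pi\<^sub>M {1..min t n} (\<lambda>_. step_space F))}"
    unfolding history_def
    by (rule sets_vimage_algebra2) (use measurable_space[OF measurable_restrict_history] in blast)
  finally obtain A where A: "{\<omega> \<in> space (sample_space F n). T \<omega> \<le> t} =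
      (\<lambda>\<omega>. restrict \<omega> {1..min t n}) -` A \<inter> space (sample_space F n)" by auto
  have "restrict \<omega> {1..min t n} = restrict \<omega>' {1..min t n}"
    using eq by (auto simp: restrict_def)
  then show ?thesis using A \<omega> by (metis (mono_tags, lifting) Int_iff mem_Collect_eq vimage_eq)
qed

section \<open>Expectations over independent steps\<close>

lemma integral_prod_sample:
  fixes f :: "nat \<Rightarrow> real \<times> real \<Rightarrow> real"
  assumes "\<And>i. i \<in> {1..n} \<Longrightarrow> integrable (step_space F) (f i)"
  shows "integrable (sample_space F n) (\<lambda>\<omega>. \<Prod>i\<in>{1..n}. f i (\<omega> i))"
    and "(\<integral>\<omega>. (\<Prod>i\<in>{1..n}. f i (\<omega> i)) \<partial>sample_space F n) = (\<Prod>i\<in>{1..n}. \<integral>z. f i z \<partial>step_space F)"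
  unfolding sample_space_def using assms
  by (auto intro!: steps.product_integrable_prod steps.product_integral_prod)

lemma integral_fst_step:
  fixes f :: "real \<Rightarrow> real"
  assumes [measurable]: "f \<in> borel_measurable borel"
  shows "(\<integral>z. f (fst z) \<partial>step_space F) = (\<integral>x. f x \<partial>F)"
    and "integrable (step_space F) (\<lambda>z. f (fst z)) \<longleftrightarrow> integrable F f"
proof -
  show "(\<integral>z. f (fst z) \<partial>step_space F) = (\<integral>x. f x \<partial>F)"
    by (subst (2) distr_fst_step[symmetric]) (simp add: integral_distr)
  show "integrable (step_space F) (\<lambda>z. f (fst z)) \<longleftrightarrow> integrable F f"
    by (subst (2) distr_fst_step[symmetric]) (simp add: integrable_distr_eq)
qed

lemma integral_component:
  assumes "integrable (step_space F) f" "i \<in> {1..n}"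
  shows "integrable (sample_space F n) (\<lambda>\<omega>. f (\<omega> i) :: real)"
    and "(\<integral>\<omega>. f (\<omega> i) \<partial>sample_space F n) = (\<integral>z. f z \<partial>step_space F)"
proof -
  have distr: "distr (sample_space F n) (step_space F) (\<lambda>\<omega>. \<omega> i) = step_space F"
    unfolding sample_space_def using assms(2)
    by (intro distr_PiM_component step.prob_space_axioms) auto
  have [measurable]: "f \<in> borel_measurable (step_space F)" using assms(1) by auto
  show "integrable (sample_space F n) (\<lambda>\<omega>. f (\<omega> i))"
    using assms by (subst integrable_distr_eq[of _ _ "step_space F" f, symmetric]) (auto simp: distr)
  show "(\<integral>\<omega>. f (\<omega> i) \<partial>sample_space F n) = (\<integral>z. f z \<partial>step_space F)"
    using assms(2) by (subst integral_distr[of _ _ "step_space F" f, symmetric]) (auto simp: distr)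
qed

lemma AE_val:
  assumes "AE x in F. P x" "i \<in> {1..n}"
  shows "AE \<omega> in sample_space F n. P (val \<omega> i)"
proof -
  have "AE x in distr (step_space F) borel fst. P x" using assms(1) unfolding distr_fst_step .
  then have "AE z in step_space F. P (fst z)" by (rule AE_distrD[rotated]) simp
  then show ?thesis unfolding sample_space_def val_def using assms(2)
    by (intro AE_PiM_component[of _ "\<lambda>_. step_space F"] step.prob_space_axioms) auto
qed

lemma integrable_val:
  assumes "integrable F (\<lambda>x. x)" "i \<in> {1..n}"
  shows "integrable (sample_space F n) (\<lambda>\<omega>. val \<omega> i)"
proof -
  have "integrable (step_space F) fst"
    using assms(1) integral_fst_step(2)[of "\<lambda>x. x"] by (simp only: measurable_ident_sets[OF refl])
  then show ?thesis unfolding val_def using assms(2) by (rule integral_component)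
qed

lemma integrable_max_value:
  assumes "integrable F (\<lambda>x. x)" "1 \<le> n"
  shows "integrable (sample_space F n) (\<lambda>\<omega>. max_value n (val \<omega>))"
proof (rule Bochner_Integration.integrable_bound)
  show "integrable (sample_space F n) (\<lambda>\<omega>. \<Sum>i\<in>{1..n}. \<bar>val \<omega> i\<bar>)"
    using integrable_val[OF assms(1)] by auto
  show "(\<lambda>\<omega>. max_value n (val \<omega>)) \<in> borel_measurable (sample_space F n)"
    unfolding max_value_def by measurable
  show "AE \<omega> in sample_space F n. norm (max_value n (val \<omega>)) \<le> norm (\<Sum>i\<in>{1..n}. \<bar>val \<omega> i\<bar>)"
  proof (rule AE_I2)
    fix \<omega>
    have "max_value n (val \<omega>) \<in> val \<omega> ` {1..n}"
      unfolding max_value_def using \<open>1 \<le> n\<close> by (intro Max_in) auto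
    then obtain i where i: "i \<in> {1..n}" "max_value n (val \<omega>) = val \<omega> i" by auto
    have "\<bar>val \<omega> i\<bar> \<le> (\<Sum>i\<in>{1..n}. \<bar>val \<omega> i\<bar>)" using i(1) by (intro member_le_sum) auto
    then show "norm (max_value n (val \<omega>)) \<le> norm (\<Sum>i\<in>{1..n}. \<bar>val \<omega> i\<bar>)" using i(2) by simp
  qed
qed

text \<open>A Bellman bound: \<open>\<Phi> k m\<close> is a potential for the state with
  \<open>k\<close> values still to come and running maximum \<open>m\<close>, and
  \<open>step\<close> requires that one more value, followed by the better of stopping and
  continuing, does not beat it. Hence the process \<open>R\<close>, which is the reward once stopped
  and the potential before, has nonincreasing expectation, from \<open>\<Phi> n 0\<close> down to a
  bound for the reward.\<close>

lemma nn_integral_reward_le_potential: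
  assumes T: "stopping_time (history F n) T"
    and T_range: "\<And>\<omega>. \<omega> \<in> space (sample_space F n) \<Longrightarrow> T \<omega> \<in> {1..n+1}"
    and "0 \<le> \<gamma>" "1 \<le> n"
    and meas [measurable]: "\<And>k. \<Phi> k \<in> borel_measurable borel"
    and step: "\<And>k m. k < n \<Longrightarrow> 0 \<le> m \<Longrightarrow>
      (\<integral>\<^sup>+ x. ennreal (max (max (\<gamma> * m) x) (\<Phi> k (max m x))) \<partial>F) \<le> ennreal (\<Phi> (Suc k) m)"
    and final: "\<And>m. 0 \<le> m \<Longrightarrow> \<gamma> * m \<le> \<Phi> 0 m"
  shows "(\<integral>\<^sup>+ \<omega>. ennreal (reward \<gamma> n (val \<omega>) (T \<omega>)) \<partial>sample_space F n) \<le> ennreal (\<Phi> n 0)"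
proof -
  \<comment> \<open>The inserted \<open>0\<close> gives the running maximum the start value
    \<open>M 0 = 0\<close> of the conclusion.\<close>
  define M where "M i \<omega> = Max (insert 0 (val \<omega> ` {1..i}))" for i \<omega>
  define R where "R i \<omega> = (if T \<omega> \<le> i then reward \<gamma> n (val \<omega>) (T \<omega>) else \<Phi> (n - i) (M i \<omega>))" for i \<omega>
  have T_meas [measurable]: "T \<in> sample_space F n \<rightarrow>\<^sub>M count_space UNIV"
    by (rule measurable_stopping_time_history[OF T])
  have M_nonneg: "0 \<le> M i \<omega>" for i \<omega> by (auto simp: M_def)
  have M_ge: "val \<omega> j \<le> M i \<omega>" if "j \<in> {1..i}" for i j \<omega>
    unfolding M_def using that by (intro Max_ge) auto
  have M_Suc: "M (Suc i) \<omega> = max (M i \<omega>) (val \<omega> (Suc i))" for i \<omega>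
  proof -
    have "insert 0 (val \<omega> ` {1..Suc i}) = insert (val \<omega> (Suc i)) (insert 0 (val \<omega> ` {1..i}))"
      by (auto simp: atLeastAtMostSuc_conv)
    then show ?thesis unfolding M_def by (simp only:) (subst Max_insert; simp add: max.commute)
  qed
  have M_meas [measurable]: "M i \<in> borel_measurable (sample_space F n)" for i
  proof (induction i)
    case 0
    show ?case by (simp add: M_def[abs_def])
  next
    case (Suc i)
    then show ?case unfolding M_Suc[abs_def] by measurable
  qed
  have R_meas [measurable]: "R i \<in> borel_measurable (sample_space F n)" for i
    unfolding R_def[abs_def] using measurable_reward[OF T_meas, of \<gamma>] by measurable
  have reward_le: "reward \<gamma> n (val \<omega>) (Suc i) \<le> max (\<gamma> * M i \<omega>) (val \<omega> (Suc i))" if "i < n" for i \<omega>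
  proof -
    have "\<gamma> * val \<omega> j \<le> \<gamma> * M i \<omega>" if "j \<in> {1..<Suc i}" for j
      using that M_ge[of j i \<omega>] \<open>0 \<le> \<gamma>\<close> by (intro mult_left_mono) auto
    then show ?thesis unfolding reward_def using that
      by (intro Max.boundedI) (auto intro: max.coboundedI1)
  qed
  have decrease: "(\<integral>\<^sup>+ \<omega>. R (Suc i) \<omega> \<partial>sample_space F n) \<le> (\<integral>\<^sup>+ \<omega>. R i \<omega> \<partial>sample_space F n)"
    if "i < n" for i
  proof -
    \<comment> \<open>Fubini with coordinate \<open>Suc i\<close> innermost: all other coordinates,
      the future ones included, stay fixed in \<open>x\<close>, and the inequality is shown for each
      \<open>x\<close> separately.\<close>
    define J where "J = {1..n} - {Suc i}"
    have J: "finite J" "Suc i \<notin> J" "{1..n} = insert (Suc i) J" using that by (auto simp: J_def)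
    have sample_eq: "sample_space F n = Pi\<^sub>M (insert (Suc i) J) (\<lambda>_. step_space F)"
      unfolding sample_space_def J(3)[symmetric] ..
    have insert_eq: "(\<integral>\<^sup>+ \<omega>. R k \<omega> \<partial>sample_space F n) =
        (\<integral>\<^sup>+ x. (\<integral>\<^sup>+ y. R k (x(Suc i := y)) \<partial>step_space F) \<partial>Pi\<^sub>M J (\<lambda>_. step_space F))" for k
      unfolding sample_eq using J
      by (intro steps.product_nn_integral_insert) (auto simp: sample_eq[symmetric])
    show ?thesis unfolding insert_eq
    proof (rule nn_integral_mono)
      fix x assume x: "x \<in> space (Pi\<^sub>M J (\<lambda>_. step_space F))"
      define \<omega> where "\<omega> y = x(Suc i := y)" for y
      have \<omega>_space: "\<omega> y \<in> space (sample_space F n)" for y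
        using x unfolding \<omega>_def space_sample J(3) by (auto simp: space_PiM PiE_def extensional_def)
      have val_\<omega>: "val (\<omega> y) (Suc i) = fst y" for y by (simp add: val_def \<omega>_def)
      \<comment> \<open>The points \<open>\<omega> y\<close> differ only at \<open>Suc i\<close>, so
        a stopping rule cannot tell them apart by time \<open>i\<close>. Whether it has stopped is
        thus decided by any representative, below by \<open>\<omega> undefined\<close>.\<close>
      have T_cong: "T (\<omega> y) \<le> i \<longleftrightarrow> T (\<omega> z) \<le> i" for y z
        by (intro stopping_time_history_cong[OF T \<omega>_space \<omega>_space]) (auto simp: \<omega>_def)
      show "(\<integral>\<^sup>+ y. R (Suc i) (x(Suc i := y)) \<partial>step_space F) \<le> (\<integral>\<^sup>+ y. R i (x(Suc i := y)) \<partial>step_space F)"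
        unfolding \<omega>_def[symmetric]
      proof (cases "T (\<omega> undefined) \<le> i")
        case True
        then have "T (\<omega> y) \<le> i" for y using T_cong by blast
        then have "R (Suc i) (\<omega> y) = R i (\<omega> y)" for y by (auto simp: R_def le_SucI)
        then show "(\<integral>\<^sup>+ y. R (Suc i) (\<omega> y) \<partial>step_space F) \<le> (\<integral>\<^sup>+ y. R i (\<omega> y) \<partial>step_space F)"
          by simp
      next
        case False
        then have T_gt: "\<not> T (\<omega> y) \<le> i" for y using T_cong by blast
        define m where "m = M i (\<omega> undefined)"
        have m: "M i (\<omega> y) = m" for y
        proof -
          have "val (\<omega> y) ` {1..i} = val (\<omega> undefined) ` {1..i}"
            by (rule image_cong) (auto simp: val_def \<omega>_def)
          then show ?thesis unfolding m_def M_def by simp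
        qed
        define k where "k = n - Suc i"
        have k: "n - i = Suc k" "k < n" using that by (auto simp: k_def)
        define g where "g z = ennreal (max (max (\<gamma> * m) z) (\<Phi> k (max m z)))" for z
        have [measurable]: "g \<in> borel_measurable borel" unfolding g_def[abs_def] by measurable
        \<comment> \<open>Not having stopped by time \<open>i\<close>, the rule either stops at
          \<open>Suc i\<close> or goes on; the maximum covers both choices.\<close>
        have "R (Suc i) (\<omega> y) \<le> max (max (\<gamma> * m) (fst y)) (\<Phi> k (max m (fst y)))" for y
        proof (cases "T (\<omega> y) \<le> Suc i")
          case True
          then have "T (\<omega> y) = Suc i" using T_gt[of y] by simp
          then show ?thesis using reward_le[OF that, of "\<omega> y"]
            by (simp add: R_def m val_\<omega> le_max_iff_disj)
        next
          case False
          then show ?thesis by (simp add: R_def M_Suc m val_\<omega> k_def)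
        qed
        then have "(\<integral>\<^sup>+ y. R (Suc i) (\<omega> y) \<partial>step_space F) \<le> (\<integral>\<^sup>+ y. g (fst y) \<partial>step_space F)"
          unfolding g_def by (intro nn_integral_mono ennreal_leI)
        also have "\<dots> = (\<integral>\<^sup>+ z. g z \<partial>distr (step_space F) borel fst)"
          by (subst nn_integral_distr) auto
        also have "\<dots> \<le> ennreal (\<Phi> (Suc k) m)"
          unfolding distr_fst_step g_def by (rule step) (auto simp: k m_def M_nonneg)
        also have "\<dots> = (\<integral>\<^sup>+ y. ennreal (\<Phi> (Suc k) m) \<partial>step_space F)"
          using step.emeasure_space_1 by simp
        also have "\<dots> = (\<integral>\<^sup>+ y. R i (\<omega> y) \<partial>step_space F)"
          using T_gt by (simp add: R_def m k)
        finally show "(\<integral>\<^sup>+ y. R (Suc i) (\<omega> y) \<partial>step_space F) \<le> (\<integral>\<^sup>+ y. R i (\<omega> y) \<partial>step_space F)" .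
      qed
    qed
  qed
  have "(\<integral>\<^sup>+ \<omega>. reward \<gamma> n (val \<omega>) (T \<omega>) \<partial>sample_space F n) \<le> (\<integral>\<^sup>+ \<omega>. R n \<omega> \<partial>sample_space F n)"
  proof (intro nn_integral_mono ennreal_leI)
    fix \<omega> assume \<omega>: "\<omega> \<in> space (sample_space F n)"
    show "reward \<gamma> n (val \<omega>) (T \<omega>) \<le> R n \<omega>"
    proof (cases "T \<omega> \<le> n")
      case False
      \<comment> \<open>The rule never stopped, so the reward is at most
        \<open>\<gamma> * M n \<omega>\<close>, which \<open>final\<close> bounds by the potential
        with no values left.\<close>
      then have T_eq: "T \<omega> = n + 1" using T_range[OF \<omega>] by simp
      have "reward \<gamma> n (val \<omega>) (T \<omega>) \<le> \<gamma> * M n \<omega>"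
        unfolding reward_def T_eq using M_ge[of _ n \<omega>] \<open>0 \<le> \<gamma>\<close> \<open>1 \<le> n\<close>
        by (auto intro!: mult_left_mono)
      then show ?thesis using final[OF M_nonneg, of n \<omega>] by (simp add: R_def T_eq)
    qed (simp add: R_def)
  qed
  also have "(\<integral>\<^sup>+ \<omega>. R n \<omega> \<partial>sample_space F n) \<le> (\<integral>\<^sup>+ \<omega>. R 0 \<omega> \<partial>sample_space F n)"
  proof -
    have "(\<integral>\<^sup>+ \<omega>. R i \<omega> \<partial>sample_space F n) \<le> (\<integral>\<^sup>+ \<omega>. R 0 \<omega> \<partial>sample_space F n)" if "i \<le> n" for i
      using that
    proof (induction i)
      case (Suc i)
      then show ?case using decrease[of i] by simp
    qed simp
    then show ?thesis by simp
  qed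
  also have "\<dots> = (\<integral>\<^sup>+ \<omega>. ennreal (\<Phi> n 0) \<partial>sample_space F n)"
    \<comment> \<open>Stopping times are at least 1, so at time 0 nothing has stopped and
      \<open>R 0\<close> is the constant \<open>\<Phi> n 0\<close>.\<close>
    using T_range by (intro nn_integral_cong) (fastforce simp: R_def M_def)
  also have "\<dots> = ennreal (\<Phi> n 0)" by (simp add: sample.emeasure_space_1)
  finally show ?thesis .
qed

end

lemma iid_sample_instance: "(F, n) \<in> iid_instances \<Longrightarrow> iid_sample F"
  by (auto simp: iid_instances_def iid_sample_def iid_sample_axioms_def)

section \<open>The hard instance\<close>

text \<open>Two Bernoulli draws give finite support, so integrals become three-term sums;
  \<open>r\<close> is the chance of the jackpot \<open>b\<close> given a nonzero value.\<close>

definition hard_dist :: "real \<Rightarrow> real \<Rightarrow> real \<Rightarrow> real measure" where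
  "hard_dist p r b = distr (measure_pmf (pair_pmf (bernoulli_pmf p) (bernoulli_pmf r))) borel
     (\<lambda>(x, y). if x then if y then b else 1 else 0)"

context
  fixes p r b :: real
  assumes p: "0 \<le> p" "p \<le> 1" and r: "0 \<le> r" "r \<le> 1"
begin

lemma prob_space_hard_dist: "prob_space (hard_dist p r b)"
  unfolding hard_dist_def by (rule measure_pmf.prob_space_distr) simp

lemma sets_hard_dist: "sets (hard_dist p r b) = sets borel"
  by (simp add: hard_dist_def)

lemma nn_integral_hard_dist:
  assumes [measurable]: "g \<in> borel_measurable borel" and g: "0 \<le> g 0" "0 \<le> g 1" "0 \<le> g b"
  shows "(\<integral>\<^sup>+ x. ennreal (g x) \<partial>hard_dist p r b) = ennreal ((1 - p) * g 0 + p * (r * g b + (1 - r) * g 1))"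
proof -
  have "(\<integral>\<^sup>+ x. ennreal (g x) \<partial>hard_dist p r b) =
      ennreal p * (ennreal r * ennreal (g b) + ennreal (1 - r) * ennreal (g 1)) +
      ennreal (1 - p) * (ennreal r * ennreal (g 0) + ennreal (1 - r) * ennreal (g 0))"
    unfolding hard_dist_def using p r
    by (subst nn_integral_distr) (auto simp: nn_integral_pair_pmf' mult.commute)
  also have "\<dots> = ennreal (p * (r * g b + (1 - r) * g 1) + (1 - p) * (r * g 0 + (1 - r) * g 0))"
    using p r g by (simp add: ennreal_mult)
  also have "r * g 0 + (1 - r) * g 0 = g 0" by (simp add: algebra_simps)
  finally show ?thesis by (simp add: add.commute)
qed

lemma integrable_hard_dist:
  assumes [measurable]: "g \<in> borel_measurable borel"
  shows "integrable (hard_dist p r b) (g :: real \<Rightarrow> real)"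
  unfolding hard_dist_def
  by (subst integrable_distr_eq) (auto intro!: integrable_measure_pmf_finite)

lemma integral_hard_dist:
  assumes [measurable]: "g \<in> borel_measurable borel" and g: "\<And>x. 0 \<le> g x"
  shows "(\<integral>x. g x \<partial>hard_dist p r b) = (1 - p) * g 0 + p * (r * g b + (1 - r) * g 1)"
proof -
  have meas: "g \<in> borel_measurable (hard_dist p r b)" using sets_hard_dist by measurable
  have "0 \<le> (1 - p) * g 0 + p * (r * g b + (1 - r) * g 1)" using p r g by simp
  then show ?thesis using g meas
    by (subst integral_eq_nn_integral) (auto simp: nn_integral_hard_dist simp del: ennreal_plus)
qed

lemma AE_hard_dist: "AE x in hard_dist p r b. x \<in> {0, 1, b}"
  unfolding hard_dist_def by (subst AE_distr_iff) (auto intro!: AE_pmfI split: if_splits)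

text \<open>Almost surely the maximum is at least the indicator of a nonzero value plus
  \<open>b - 1\<close> times the indicator of a jackpot. The complements of both events are products
  of one-step indicators, so independence gives the powers.\<close>

lemma expected_max_hard_dist_ge:
  assumes b: "1 < b" and n: "1 \<le> n"
  shows "expected_max (hard_dist p r b) n \<ge> 1 - (1 - p) ^ n + (b - 1) * (1 - (1 - p * r) ^ n)"
proof -
  interpret iid_sample "hard_dist p r b" n
    using prob_space_hard_dist sets_hard_dist by (simp add: iid_sample_def iid_sample_axioms_def)
  have prod: "integrable (sample_space (hard_dist p r b) n) (\<lambda>\<omega>. \<Prod>i\<in>{1..n}. g (val \<omega> i))"
    "(\<integral>\<omega>. (\<Prod>i\<in>{1..n}. g (val \<omega> i)) \<partial>sample_space (hard_dist p r b) n) =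
      ((1 - p) * g 0 + p * (r * g b + (1 - r) * g 1)) ^ n"
    if [measurable]: "g \<in> borel_measurable borel" and "\<And>x. 0 \<le> g x" for g
  proof -
    have int: "integrable (step_space (hard_dist p r b)) (\<lambda>z. g (fst z))"
      by (simp add: integral_fst_step(2) integrable_hard_dist)
    show "integrable (sample_space (hard_dist p r b) n) (\<lambda>\<omega>. \<Prod>i\<in>{1..n}. g (val \<omega> i))"
      unfolding val_def by (intro integral_prod_sample(1) int)
    show "(\<integral>\<omega>. (\<Prod>i\<in>{1..n}. g (val \<omega> i)) \<partial>sample_space (hard_dist p r b) n) =
        ((1 - p) * g 0 + p * (r * g b + (1 - r) * g 1)) ^ n"
      unfolding val_def using int that
      by (subst integral_prod_sample(2)) (simp_all add: integral_fst_step integral_hard_dist)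
  qed
  note prod0 = prod[of "indicator {0}"] and prodb = prod[of "indicator (- {b})"]
  have "1 - (1 - p) ^ n + (b - 1) * (1 - (1 - p * r) ^ n) =
    (\<integral>\<omega>. 1 - (\<Prod>i\<in>{1..n}. indicator {0} (val \<omega> i)) + (b - 1) * (1 - (\<Prod>i\<in>{1..n}. indicator (- {b}) (val \<omega> i)))
      \<partial>sample_space (hard_dist p r b) n)"
    using prod0 prodb b by (simp add: sample.prob_space algebra_simps)
  also have "\<dots> \<le> expected_max (hard_dist p r b) n"
    unfolding expected_max_def
  proof (rule integral_mono_AE)
    show "integrable (sample_space (hard_dist p r b) n) (\<lambda>\<omega>. max_value n (val \<omega>))"
      using n by (intro integrable_max_value integrable_hard_dist) auto
    show "integrable (sample_space (hard_dist p r b) n) (\<lambda>\<omega>. 1 - (\<Prod>i\<in>{1..n}. indicator {0} (val \<omega> i)) +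
        (b - 1) * (1 - (\<Prod>i\<in>{1..n}. indicator (- {b}) (val \<omega> i))))"
      using prod0(1) prodb(1) by auto
    have "AE \<omega> in sample_space (hard_dist p r b) n. \<forall>i\<in>{1..n}. val \<omega> i \<in> {0, 1, b}"
      by (intro AE_finite_allI AE_val[OF AE_hard_dist]) auto
    then show "AE \<omega> in sample_space (hard_dist p r b) n. 1 - (\<Prod>i\<in>{1..n}. indicator {0} (val \<omega> i)) +
        (b - 1) * (1 - (\<Prod>i\<in>{1..n}. indicator (- {b}) (val \<omega> i))) \<le> max_value n (val \<omega>)"
    proof eventually_elim
      case (elim \<omega>)
      have max_ge: "val \<omega> i \<le> max_value n (val \<omega>)" if "i \<in> {1..n}" for i
        unfolding max_value_def using that by (intro Max_ge) auto
      have prod_cases: "(\<Prod>i\<in>{1..n}. indicator A (val \<omega> i)) = (if \<forall>i\<in>{1..n}. val \<omega> i \<in> A then 1 else (0::real))" for A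
        by (auto simp: indicator_def prod_zero_iff)
      have "0 \<le> max_value n (val \<omega>)" using elim[rule_format, of 1] max_ge[of 1] n b by auto
      moreover have "b \<le> max_value n (val \<omega>)" if "\<not> (\<forall>i\<in>{1..n}. val \<omega> i \<in> - {b})"
        using that max_ge by auto
      moreover have "1 \<le> max_value n (val \<omega>)"
        if "\<forall>i\<in>{1..n}. val \<omega> i \<in> - {b}" "\<exists>i\<in>{1..n}. val \<omega> i \<noteq> 0"
      proof -
        from that(2) obtain i where "i \<in> {1..n}" "val \<omega> i \<noteq> 0" by blast
        then have "val \<omega> i = 1" using that(1) elim by blast
        then show ?thesis using max_ge[OF \<open>i \<in> {1..n}\<close>] by simp
      qed
      ultimately show ?case unfolding prod_cases by (auto split: if_split)
    qed
  qed
  finally show ?thesis .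
qed

end

text \<open>
  \<open>W s = 1 + w * kink (s - s\<^sub>0)\<close>, where \<open>s\<^sub>0 = ln (3 - \<gamma>) / 2\<close> is the remaining time at which \<open>W = 1\<close>.
  The branch \<open>u > 0\<close> is the tangent of the other branch at 0.
\<close>

definition kink :: "real \<Rightarrow> real" where
  "kink u = (if u \<le> 0 then (1 - exp (-2 * u)) / 2 else u)"

text \<open>The left side is concave in \<open>u\<close> with tangent \<open>u\<close> at 0.\<close>

lemma kink_ge: "(1 - exp (-2 * u)) / 2 \<le> kink u"
  using exp_ge_add_one_self[of "-2 * u"] by (simp add: kink_def)

text \<open>\<open>kink\<close> solves \<open>y' = 1 + 2 * max 0 (- y)\<close>, and this is a
  discrete step of length \<open>h\<close> in which a nonzero value has probability
  \<open>1 - exp (-2 * h)\<close>. For \<open>u \<le> 0\<close> the left side is the exponential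
  branch at \<open>u + h\<close> exactly; for \<open>u > 0\<close> the step gains at most
  \<open>h\<close>.\<close>

lemma kink_step:
  assumes "0 \<le> h"
  shows "kink u + (1 - exp (-2 * h)) * (1/2 + max 0 (- kink u)) \<le> kink (u + h)"
proof (cases "u \<le> 0")
  case True
  then have k: "kink u = (1 - exp (-2 * u)) / 2" and m: "max 0 (- kink u) = (exp (-2 * u) - 1) / 2"
    by (simp_all add: kink_def field_simps)
  have "kink u + (1 - exp (-2 * h)) * (1/2 + max 0 (- kink u)) = (1 - exp (-2 * u) * exp (-2 * h)) / 2"
    unfolding m unfolding k by (simp add: field_simps)
  also have "exp (-2 * u) * exp (-2 * h) = exp (-2 * (u + h))" by (simp add: algebra_simps flip: exp_add)
  also have "(1 - exp (-2 * (u + h))) / 2 \<le> kink (u + h)" by (rule kink_ge)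
  finally show ?thesis .
next
  case False
  then have "kink u = u" "kink (u + h) = u + h" using assms by (simp_all add: kink_def)
  then show ?thesis using False exp_ge_add_one_self[of "-2 * h"] by (simp add: max_def)
qed

lemma kink_mono: "u \<le> v \<Longrightarrow> kink u \<le> kink v"
proof -
  assume "u \<le> v"
  then have "0 \<le> (1 - exp (-2 * (v - u))) * (1/2 + max 0 (- kink u))"
    by (intro mult_nonneg_nonneg) auto
  moreover have "kink (u + (v - u)) = kink v" by simp
  ultimately show ?thesis using kink_step[of "v - u" u] \<open>u \<le> v\<close> by linarith
qed

section \<open>Potentials for the hard instance\<close>

context
  fixes \<gamma> :: real
  assumes \<gamma>: "0 \<le> \<gamma>" "\<gamma> \<le> 1"
begin

text \<open>This is the limit contribution \<open>w\<close> of the jackpot. Together with the offset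
  \<open>ln (3 - \<gamma>) / 2\<close> it produces the start value
  \<open>value_seen 0 = \<gamma>\<close>, as
  \<open>1 - w * (2 - \<gamma>) / 2 = \<gamma>\<close>.\<close>

definition jackpot :: real where "jackpot = 2 * (1 - \<gamma>) / (2 - \<gamma>)"

definition value_seen :: "real \<Rightarrow> real" where
  "value_seen s = 1 + jackpot * kink (s - ln (3 - \<gamma>) / 2)"

text \<open>Both potentials solve \<open>y' = jackpot + 2 * (max 1 W - y)\<close> with
  \<open>W = value_seen\<close>, so their difference decays like \<open>exp (-2 * s)\<close>,
  starting from \<open>\<gamma> - 0\<close>.\<close>

definition value_unseen :: "real \<Rightarrow> real" where
  "value_unseen s = value_seen s - \<gamma> * exp (-2 * s)"

lemma jackpot_bounds: "0 \<le> jackpot" "jackpot \<le> 1"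
  using \<gamma> by (auto simp: jackpot_def field_simps)

text \<open>Scaled form of \<open>kink_step\<close>: since \<open>jackpot \<ge> 0\<close>, the gain
  \<open>max 1 W - W\<close> is \<open>jackpot\<close> times \<open>max 0 (- kink)\<close>. The term
  \<open>jackpot / 2\<close> is the mean jackpot payment of one nonzero value in
  \<open>hard_instance\<close>.\<close>

lemma value_seen_step:
  assumes "0 \<le> h"
  defines "p \<equiv> 1 - exp (-2 * h)"
  shows "(1 - p) * value_seen s + p * (jackpot / 2 + max 1 (value_seen s)) \<le> value_seen (s + h)"
proof -
  define k where "k = kink (s - ln (3 - \<gamma>) / 2)"
  have V: "value_seen s = 1 + jackpot * k" by (simp add: value_seen_def k_def)
  have "jackpot * (k + p * (1/2 + max 0 (- k))) \<le> jackpot * kink (s - ln (3 - \<gamma>) / 2 + h)"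
    unfolding k_def p_def using jackpot_bounds assms(1) by (intro mult_left_mono kink_step)
  then have "1 + jackpot * (k + p * (1/2 + max 0 (- k))) \<le> value_seen (s + h)"
    by (simp add: value_seen_def algebra_simps)
  moreover have "max 1 (1 + jackpot * k) = 1 + jackpot * k + jackpot * max 0 (- k)"
    using jackpot_bounds by (auto simp: max_def mult_le_0_iff zero_le_mult_iff algebra_simps)
  ultimately show ?thesis unfolding V by (simp add: algebra_simps)
qed

lemma value_seen_0: "value_seen 0 = \<gamma>"
proof -
  have "0 \<le> ln (3 - \<gamma>)" using \<gamma> by simp
  then have "kink (0 - ln (3 - \<gamma>) / 2) = (1 - (3 - \<gamma>)) / 2" using \<gamma> by (simp add: kink_def)
  then have "value_seen 0 = 1 + jackpot * ((1 - (3 - \<gamma>)) / 2)" by (simp only: value_seen_def)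
  also have "\<dots> = \<gamma>" using \<gamma> by (simp add: jackpot_def field_simps)
  finally show ?thesis .
qed

lemma value_seen_ge: "0 \<le> s \<Longrightarrow> \<gamma> \<le> value_seen s"
  using mult_left_mono[OF kink_mono[of "0 - ln (3 - \<gamma>) / 2" "s - ln (3 - \<gamma>) / 2"] jackpot_bounds(1)]
  by (subst value_seen_0[symmetric]) (simp add: value_seen_def)

lemma value_unseen_0: "value_unseen 0 = 0"
  by (simp add: value_unseen_def value_seen_0)

lemma value_unseen_nonneg: "0 \<le> s \<Longrightarrow> 0 \<le> value_unseen s"
proof -
  assume "0 \<le> s"
  then have "\<gamma> * exp (-2 * s) \<le> \<gamma> * 1" using \<gamma> by (intro mult_left_mono) auto
  then show ?thesis using value_seen_ge[OF \<open>0 \<le> s\<close>] by (simp add: value_unseen_def)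
qed

text \<open>The recursion has the same inhomogeneous term as for \<open>value_seen\<close>, and the
  correction \<open>\<gamma> * exp (-2 * s)\<close> shrinks by exactly the factor
  \<open>1 - p\<close> in a step.\<close>

lemma value_unseen_step:
  assumes "0 \<le> h"
  defines "p \<equiv> 1 - exp (-2 * h)"
  shows "(1 - p) * value_unseen s + p * (jackpot / 2 + max 1 (value_seen s)) \<le> value_unseen (s + h)"
proof -
  have "exp (-2 * (s + h)) = (1 - p) * exp (-2 * s)" by (simp add: p_def algebra_simps flip: exp_add)
  then have "\<gamma> * exp (-2 * (s + h)) = (1 - p) * (\<gamma> * exp (-2 * s))" by simp
  moreover have "(1 - p) * value_unseen s = (1 - p) * value_seen s - (1 - p) * (\<gamma> * exp (-2 * s))"
    unfolding value_unseen_def by (rule right_diff_distrib)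
  ultimately show ?thesis using value_seen_step[OF assms(1), of s, folded p_def]
    unfolding value_unseen_def[of "s + h"] by linarith
qed

lemma U_eq_value_quotient: "value_unseen 1 / (1 - exp (-2) + jackpot) = U \<gamma>"
proof -
  \<comment> \<open>As \<open>3 - \<gamma> \<le> exp 2\<close>, the linear branch of
    \<open>kink\<close> applies when the whole time 1 is left.\<close>
  have "ln (3 - \<gamma>) \<le> ln (exp 2)"
    using \<gamma> exp_lower_Taylor_quadratic[of 2] by (subst ln_le_cancel_iff) auto
  then have kink1: "kink (1 - ln (3 - \<gamma>) / 2) = 1 - ln (3 - \<gamma>) / 2" by (auto simp: kink_def)
  define E where "E = exp (2::real)"
  have E: "3 \<le> E" unfolding E_def using exp_lower_Taylor_quadratic[of 2] by simp
  have Em: "exp (-2) = 1 / E" by (simp add: E_def exp_minus field_simps)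
  define D where "D = 2 * (2 * E - 1) - (3 * E - 1) * \<gamma>"
  have D_pos: "0 < D"
  proof -
    have "D = (3 * E - 1) * (1 - \<gamma>) + (E - 1)" by (simp add: D_def algebra_simps)
    then show ?thesis using \<gamma> E by (simp add: add_nonneg_pos)
  qed
  \<comment> \<open>Multiplying by \<open>(2 - \<gamma>) * E\<close> clears the denominators of
    \<open>jackpot\<close> and \<open>exp (-2)\<close>; what results is the denominator of
    \<open>U\<close>.\<close>
  have "(1 - exp (-2) + jackpot) * ((2 - \<gamma>) * E) = D"
    using \<gamma> E unfolding Em jackpot_def D_def by (simp add: field_simps)
  moreover have "value_unseen 1 * ((2 - \<gamma>) * E) = D - (1 - \<gamma>) * (E * ln (3 - \<gamma>) - (2 - \<gamma>))"
  proof -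
    have "value_unseen 1 = 1 + jackpot * (1 - ln (3 - \<gamma>) / 2) - \<gamma> / E"
      unfolding value_unseen_def value_seen_def kink1 using Em by simp
    also have "\<dots> * ((2 - \<gamma>) * E) = (2 - \<gamma>) * E + 2 * (1 - \<gamma>) * E * (1 - ln (3 - \<gamma>) / 2) - \<gamma> * (2 - \<gamma>)"
      using \<gamma> E unfolding jackpot_def by (simp add: field_simps)
    also have "\<dots> = D - (1 - \<gamma>) * (E * ln (3 - \<gamma>) - (2 - \<gamma>))"
      unfolding D_def by (simp add: field_simps)
    finally show ?thesis .
  qed
  ultimately have "value_unseen 1 / (1 - exp (-2) + jackpot) = (D - (1 - \<gamma>) * (E * ln (3 - \<gamma>) - (2 - \<gamma>))) / D"
    using \<gamma> E by (metis mult_divide_mult_cancel_right mult_eq_0_iff diff_gt_0_iff_gt less_irrefl le_less_trans not_numeral_le_zero one_less_numeral_iff semiring_norm(76))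
  also have "\<dots> = U \<gamma>" using D_pos unfolding U_def E_def[symmetric] D_def[symmetric]
    by (simp add: field_simps)
  finally show ?thesis .
qed

end

section \<open>Upper bound for every algorithm\<close>

lemma expected_reward_nonneg:
  assumes "(F, n) \<in> iid_instances" "0 \<le> \<gamma>" and A: "online_algorithm A"
  shows "0 \<le> expected_reward \<gamma> A F n"
  unfolding expected_reward_def
proof (rule integral_nonneg_AE)
  interpret iid_sample F n using assms(1) by (rule iid_sample_instance)
  have "AE \<omega> in sample_space F n. \<forall>i\<in>{1..n}. 0 \<le> val \<omega> i"
    using assms(1) by (intro AE_finite_allI AE_val) (auto simp: iid_instances_def)
  then show "AE \<omega> in sample_space F n. 0 \<le> reward \<gamma> n (val \<omega>) (A F n \<omega>)"
    using AE_space
  proof eventually_elim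
    case (elim \<omega>)
    define S where "S = (if A F n \<omega> \<le> n then {val \<omega> (A F n \<omega>)} else {}) \<union> (\<lambda>i. \<gamma> * val \<omega> i) ` {1..<A F n \<omega>}"
    have range: "A F n \<omega> \<in> {1..n+1}" "1 \<le> n"
      using A assms(1) elim unfolding online_algorithm_def by (auto simp: iid_instances_def)
    then have "finite S" "S \<noteq> {}" "\<And>x. x \<in> S \<Longrightarrow> 0 \<le> x"
      using elim \<open>0 \<le> \<gamma>\<close> by (auto simp: S_def split: if_splits)
    then have "0 \<le> Max S" using Max_in by blast
    then show ?case by (simp add: reward_def S_def)
  qed
qed

lemma competitive_ratio_le:
  assumes "(F, n) \<in> iid_instances" "0 \<le> \<gamma>" "online_algorithm A"
  shows "competitive_ratio \<gamma> iid_instances A \<le> expected_reward \<gamma> A F n / expected_max F n"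
proof -
  \<comment> \<open>A real infimum can be compared with its members once the set is bounded below;
    nonnegative rewards give the bound 0.\<close>
  have "bdd_below ((\<lambda>(F, n). expected_reward \<gamma> A F n / expected_max F n) ` iid_instances)"
  proof (rule bdd_belowI)
    fix x assume "x \<in> (\<lambda>(F, n). expected_reward \<gamma> A F n / expected_max F n) ` iid_instances"
    then obtain F n where Fn: "(F, n) \<in> iid_instances" "x = expected_reward \<gamma> A F n / expected_max F n"
      by auto
    then show "0 \<le> x" using expected_reward_nonneg[OF Fn(1) assms(2,3)]
      by (auto simp: iid_instances_def)
  qed
  from cINF_lower[OF this assms(1)] show ?thesis by (simp add: competitive_ratio_def)
qed

context
  fixes \<gamma> :: real and n :: nat
  assumes \<gamma>: "0 \<le> \<gamma>" "\<gamma> \<le> 1" and n: "2 \<le> n"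
begin

text \<open>One value is a time step of length \<open>1 / n\<close>: it is zero with probability
  \<open>exp (-2 / n)\<close>, the factor \<open>1 - p\<close> in the step lemmas for the
  potentials, and the jackpot \<open>n\<close> pays \<open>jackpot / 2\<close> on average per
  nonzero value.\<close>

definition hard_instance :: "real measure" where
  "hard_instance = hard_dist (1 - exp (-2 * (1 / n))) (jackpot \<gamma> / (2 * real n)) n"

lemma hard_instance_params:
  "0 \<le> 1 - exp (-2 * (1 / real n))" "1 - exp (-2 * (1 / real n)) \<le> 1"
  "0 \<le> jackpot \<gamma> / (2 * real n)" "jackpot \<gamma> / (2 * real n) \<le> 1"
  using jackpot_bounds[OF \<gamma>] n by (auto simp: field_simps)

lemma expected_max_hard_instance:
  "expected_max hard_instance n \<ge>
     1 - exp (-2) + (real n - 1) * (1 - exp (- ((1 - exp (-2 * (1 / real n))) * jackpot \<gamma> / 2)))"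
proof -
  \<comment> \<open>\<open>q\<close> is the probability that a given value is the jackpot;
    \<open>(1 - q) ^ n \<le> exp (- n * q)\<close> replaces the power by an expression whose limit
    is easy to compute.\<close>
  define q where "q = (1 - exp (-2 * (1 / real n))) * (jackpot \<gamma> / (2 * real n))"
  have q: "0 \<le> q" "q \<le> 1" unfolding q_def
    by (rule mult_nonneg_nonneg mult_le_one hard_instance_params)+
  have zero: "(1 - (1 - exp (-2 * (1 / real n)))) ^ n = exp (-2)"
    using n by (simp flip: exp_of_nat_mult)
  have "(1 - q) ^ n \<le> exp (- q) ^ n"
    using q exp_ge_add_one_self[of "- q"] by (intro power_mono) auto
  also have "\<dots> = exp (- ((1 - exp (-2 * (1 / real n))) * jackpot \<gamma> / 2))"
    using n by (simp add: q_def flip: exp_of_nat_mult)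
  finally have "(real n - 1) * (1 - exp (- ((1 - exp (-2 * (1 / real n))) * jackpot \<gamma> / 2)))
      \<le> (real n - 1) * (1 - (1 - q) ^ n)"
    using n by (intro mult_left_mono) auto
  moreover have "1 - (1 - (1 - exp (-2 * (1 / real n)))) ^ n + (real n - 1) * (1 - (1 - q) ^ n)
      \<le> expected_max hard_instance n"
    unfolding hard_instance_def q_def
    using n by (intro expected_max_hard_dist_ge hard_instance_params) auto
  ultimately show ?thesis unfolding zero by linarith
qed

lemma hard_instance_in_iid_instances: "(hard_instance, n) \<in> iid_instances"
proof -
  have "0 \<le> (real n - 1) * (1 - exp (- ((1 - exp (-2 * (1 / real n))) * jackpot \<gamma> / 2)))"
    using n hard_instance_params jackpot_bounds[OF \<gamma>] by (intro mult_nonneg_nonneg) auto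
  moreover have "exp (-2) < (1::real)" by simp
  ultimately have "0 < expected_max hard_instance n"
    using expected_max_hard_instance by linarith
  moreover have "AE x in hard_instance. 0 \<le> x"
    using AE_hard_dist[OF hard_instance_params, of "real n"] unfolding hard_instance_def
    by eventually_elim auto
  moreover have "prob_space hard_instance" "sets hard_instance = sets borel"
    "integrable hard_instance (\<lambda>x. x)"
    unfolding hard_instance_def
    by (rule prob_space_hard_dist[OF hard_instance_params] sets_hard_dist[OF hard_instance_params]
        integrable_hard_dist[OF hard_instance_params] measurable_ident_sets refl)+
  ultimately show ?thesis unfolding iid_instances_def using n by simp
qed

lemma expected_reward_hard_instance:
  assumes A: "online_algorithm A"
  shows "expected_reward \<gamma> A hard_instance n \<le> value_unseen \<gamma> 1"
proof -
  define p where "p = 1 - exp (-2 * (1 / real n))"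
  define r where "r = jackpot \<gamma> / (2 * real n)"
  have pr: "0 \<le> p" "p \<le> 1" "0 \<le> r" "r \<le> 1" using hard_instance_params by (auto simp: p_def r_def)
  have F_eq: "hard_instance = hard_dist p r n" by (simp add: hard_instance_def p_def r_def)
  interpret iid_sample hard_instance n
    using hard_instance_in_iid_instances by (rule iid_sample_instance)
  \<comment> \<open>The three ranges of \<open>m\<close> stand for the states with nothing, a unit
    value or a jackpot seen; intermediate \<open>m\<close> are included because the potential bound
    ranges over all \<open>m \<ge> 0\<close>.\<close>
  define \<Phi> where "\<Phi> k m = (if m \<le> 0 then value_unseen \<gamma> (k / n) else if m \<le> 1 then value_seen \<gamma> (k / n)
    else max m (real n))" for k :: nat and m :: real
  have A': "stopping_time (history hard_instance n) (A hard_instance n)"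
    "\<And>\<omega>. \<omega> \<in> space (sample_space hard_instance n) \<Longrightarrow> A hard_instance n \<omega> \<in> {1..n+1}"
    using A hard_instance_in_iid_instances unfolding online_algorithm_def by auto
  have unseen_nonneg: "0 \<le> value_unseen \<gamma> (real k / real n)" for k
    by (intro value_unseen_nonneg[OF \<gamma>]) simp
  have seen_ge: "\<gamma> \<le> value_seen \<gamma> (real k / real n)" for k
    by (intro value_seen_ge[OF \<gamma>]) simp
  have "(\<integral>\<^sup>+ \<omega>. ennreal (reward \<gamma> n (val \<omega>) (A hard_instance n \<omega>)) \<partial>sample_space hard_instance n)
      \<le> ennreal (\<Phi> n 0)"
  proof (rule nn_integral_reward_le_potential[OF A'])
    show "0 \<le> \<gamma>" "1 \<le> n" using \<gamma> n by auto
    show "\<Phi> k \<in> borel_measurable borel" for k unfolding \<Phi>_def[abs_def] by measurable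
    show "\<gamma> * m \<le> \<Phi> 0 m" if "0 \<le> m" for m
    proof -
      have "\<gamma> * m \<le> m" using \<gamma> that by (simp add: mult_left_le_one_le)
      moreover have "\<gamma> * m \<le> \<gamma>" if "m \<le> 1" using \<gamma> that by (simp add: mult_left_le)
      ultimately show ?thesis using that
        by (auto simp: \<Phi>_def value_unseen_0[OF \<gamma>] value_seen_0[OF \<gamma>] le_max_iff_disj)
    qed
    fix k and m :: real
    assume k: "k < n" and m: "0 \<le> m"
    define s where "s = real k / real n"
    define g where "g x = max (max (\<gamma> * m) x) (\<Phi> k (max m x))" for x
    have Suc_k: "real (Suc k) / real n = s + 1 / n" by (simp add: s_def add_divide_distrib)
    have [measurable]: "g \<in> borel_measurable borel" unfolding g_def \<Phi>_def by measurable
    have g_nonneg: "0 \<le> g 0" "0 \<le> g 1" "0 \<le> g (real n)" by (auto simp: g_def le_max_iff_disj)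
    have prb: "p * (r * n) = p * (jackpot \<gamma> / 2)" using n by (simp add: r_def)
    have "(1 - p) * g 0 + p * (r * g (real n) + (1 - r) * g 1) \<le> \<Phi> (Suc k) m"
    proof -
      \<comment> \<open>The exact payoff carries the factor \<open>1 - r\<close> on the unit part.
        Raising it to 1 only increases the payoff, which is why the continuous potentials dominate
        the finite problem without an error term.\<close>
      have unit: "p * (r * n + (1 - r) * max 1 (value_seen \<gamma> s))
          \<le> p * (jackpot \<gamma> / 2 + max 1 (value_seen \<gamma> s))"
      proof -
        have "(1 - r) * max 1 (value_seen \<gamma> s) \<le> 1 * max 1 (value_seen \<gamma> s)"
          using pr by (intro mult_right_mono) auto
        then have "p * ((1 - r) * max 1 (value_seen \<gamma> s)) \<le> p * max 1 (value_seen \<gamma> s)"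
          using pr by (intro mult_left_mono) auto
        then show ?thesis unfolding distrib_left using prb by linarith
      qed
      have n1: "1 < real n" using n by simp
      consider "m = 0" | "0 < m" "m \<le> 1" | "1 < m" using m by linarith
      then show ?thesis
      proof cases
        case 1
        have "g 0 = value_unseen \<gamma> s" "g 1 = max 1 (value_seen \<gamma> s)" "g (real n) = n"
          using 1 n1 unseen_nonneg[of k] by (auto simp: g_def \<Phi>_def s_def)
        moreover have "\<Phi> (Suc k) m = value_unseen \<gamma> (s + 1 / n)"
          unfolding \<Phi>_def Suc_k using 1 by simp
        ultimately show ?thesis
          using unit value_unseen_step[OF \<gamma>, of "1 / n" s, folded p_def] by simp
      next
        case 2
        \<comment> \<open>Since
          \<open>\<gamma> * m \<le> \<gamma> \<le> value_seen \<gamma> s\<close>, falling back on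
          the past never beats continuing after a zero value.\<close>
        have "\<gamma> * m \<le> \<gamma>" "\<gamma> * m \<le> 1" using 2 \<gamma> by (auto simp: mult_left_le mult_le_one)
        then have "g 0 = value_seen \<gamma> s" "g 1 = max 1 (value_seen \<gamma> s)" "g (real n) = n"
          using 2 n1 \<gamma> seen_ge[of k] by (auto simp: g_def \<Phi>_def s_def max_def)
        moreover have "\<Phi> (Suc k) m = value_seen \<gamma> (s + 1 / n)"
          unfolding \<Phi>_def Suc_k using 2 by simp
        ultimately show ?thesis
          using unit value_seen_step[OF \<gamma>, of "1 / n" s, folded p_def] by simp
      next
        case 3
        have "\<gamma> * m \<le> m" using 3 \<gamma> by (simp add: mult_left_le_one_le)
        then have "g 0 = max m n" "g 1 = max m n" "g (real n) = max m n"
          using 3 n1 by (auto simp: g_def \<Phi>_def max_def)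
        then show ?thesis using 3 by (simp add: \<Phi>_def algebra_simps)
      qed
    qed
    then show "(\<integral>\<^sup>+ x. ennreal (max (max (\<gamma> * m) x) (\<Phi> k (max m x))) \<partial>hard_instance) \<le> ennreal (\<Phi> (Suc k) m)"
      unfolding g_def[symmetric] F_eq
      by (subst nn_integral_hard_dist[OF pr]) (auto simp: g_nonneg intro: ennreal_leI)
  qed
  also have "\<Phi> n 0 = value_unseen \<gamma> 1" using n by (simp add: \<Phi>_def)
  finally show ?thesis unfolding expected_reward_def
    using value_unseen_nonneg[OF \<gamma>, of 1] integral_real_bounded by auto
qed

end

text \<open>Every \<open>n \<ge> 2\<close> bounds the ratio by
  \<open>value_unseen \<gamma> 1 / L n\<close>, where \<open>L n\<close> bounds the expected maximum
  of the hard instance from below; these bounds tend to \<open>U \<gamma>\<close>.\<close>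

lemma competitive_ratio_le_U:
  assumes \<gamma>: "0 \<le> \<gamma>" "\<gamma> \<le> 1" and A: "online_algorithm A"
  shows "competitive_ratio \<gamma> iid_instances A \<le> U \<gamma>"
proof -
  define w where "w = jackpot \<gamma>"
  define L where "L n = 1 - exp (-2) + (real n - 1) * (1 - exp (- ((1 - exp (-2 * (1 / real n))) * w / 2)))" for n
  have w: "0 \<le> w" using jackpot_bounds[OF \<gamma>] by (simp add: w_def)
  have "L \<longlonglongrightarrow> 1 - exp (-2) + w"
  \<comment> \<open>The case \<open>w = 0\<close> arises for \<open>\<gamma> = 1\<close>, where
    \<open>L\<close> is constant; the asymptotic expansion is carried out for
    \<open>w > 0\<close>.\<close>
  proof (cases "w = 0")
    case False
    with w have "0 < w" by simp
    then show ?thesis unfolding L_def by real_asymp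
  qed (simp add: L_def[abs_def])
  moreover have "1 - exp (-2) + w \<noteq> 0"
  proof -
    have "exp (-2) < (1::real)" by simp
    then show ?thesis using w by linarith
  qed
  ultimately have "(\<lambda>n. value_unseen \<gamma> 1 / L n) \<longlonglongrightarrow> value_unseen \<gamma> 1 / (1 - exp (-2) + w)"
    by (intro tendsto_intros)
  then have lim: "(\<lambda>n. value_unseen \<gamma> 1 / L n) \<longlonglongrightarrow> U \<gamma>"
    unfolding w_def U_eq_value_quotient[OF \<gamma>] .
  show ?thesis
  proof (rule LIMSEQ_le_const[OF lim], intro exI allI impI)
    fix n :: nat assume n: "2 \<le> n"
    have "0 \<le> (real n - 1) * (1 - exp (- ((1 - exp (-2 * (1 / real n))) * w / 2)))"
      using n w hard_instance_params(1)[OF \<gamma> n] by (intro mult_nonneg_nonneg) auto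
    moreover have "exp (-2) < (1::real)" by simp
    ultimately have L_pos: "0 < L n" unfolding L_def by linarith
    have "competitive_ratio \<gamma> iid_instances A
        \<le> expected_reward \<gamma> A (hard_instance \<gamma> n) n / expected_max (hard_instance \<gamma> n) n"
      by (rule competitive_ratio_le[OF hard_instance_in_iid_instances[OF \<gamma> n] \<gamma>(1) A])
    also have "\<dots> \<le> value_unseen \<gamma> 1 / L n"
      using expected_max_hard_instance[OF \<gamma> n] expected_reward_hard_instance[OF \<gamma> n A] L_pos
        value_unseen_nonneg[OF \<gamma>, of 1]
      by (intro frac_le) (auto simp: L_def w_def)
    finally show "competitive_ratio \<gamma> iid_instances A \<le> value_unseen \<gamma> 1 / L n" .
  qed
qed

section \<open>Single-threshold algorithms\<close>

lemma first_time_range: "first_time n P \<in> {1..n+1}"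
proof -
  have "first_time n P = n + 1 \<or> first_time n P \<in> {1..n} \<and> P (first_time n P)"
    unfolding first_time_def by (rule LeastI[of _ "n + 1"]) simp
  then show ?thesis by auto
qed

lemma first_time_accepts: "first_time n P \<le> n \<Longrightarrow> P (first_time n P)"
proof -
  assume "first_time n P \<le> n"
  moreover have "first_time n P = n + 1 \<or> first_time n P \<in> {1..n} \<and> P (first_time n P)"
    unfolding first_time_def by (rule LeastI[of _ "n + 1"]) simp
  ultimately show ?thesis by auto
qed

lemma first_time_le:
  assumes "i \<in> {1..n}" "P i"
  shows "first_time n P \<le> i"
  unfolding first_time_def by (rule Least_le) (use assms in auto)

lemma first_time_le_iff: "t \<le> n \<Longrightarrow> first_time n P \<le> t \<longleftrightarrow> (\<exists>i\<in>{1..t}. P i)"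
  using first_time_accepts[of n P] first_time_le[of _ n P] first_time_range[of n P] by fastforce

text \<open>Upon acceptance the reward is at least \<open>\<theta>\<close> plus the excess over
  \<open>\<theta>\<close>, otherwise at least \<open>\<gamma>\<close> times the maximum. Events are
  written as products over steps so that expectations factor. Values equal to
  \<open>\<theta>\<close> may go either way, which covers both kinds of threshold rule.\<close>

lemma reward_first_time_ge:
  assumes "1 \<le> n"
    and above: "\<And>i. i \<in> {1..n} \<Longrightarrow> P i \<Longrightarrow> \<theta> \<le> x i"
    and below: "\<And>i. i \<in> {1..n} \<Longrightarrow> \<not> P i \<Longrightarrow> x i \<le> \<theta>"
  shows "(1 - (\<Prod>j\<in>{1..n}. of_bool (\<not> P j))) * \<theta>
      + (\<Sum>i\<in>{1..n}. (\<Prod>j\<in>{1..<i}. of_bool (\<not> P j)) * max 0 (x i - \<theta>))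
      + \<gamma> * ((\<Prod>j\<in>{1..n}. of_bool (\<not> P j)) * max_value n x)
    \<le> reward \<gamma> n x (first_time n P)"
proof (cases "\<exists>i\<in>{1..n}. P i")
  case True
  define t where "t = first_time n P"
  have t: "t \<in> {1..n}" "P t" "\<And>i. i \<in> {1..<t} \<Longrightarrow> \<not> P i"
    using True first_time_le_iff[of n n P] first_time_accepts[of n P] first_time_range[of n P]
      first_time_le[of _ n P] unfolding t_def by fastforce+
  \<comment> \<open>Only the accepted index \<open>t\<close> survives: earlier values are at most
    \<open>\<theta>\<close>, and later products contain the zero factor of \<open>t\<close>.\<close>
  have "(\<Sum>i\<in>{1..n}. (\<Prod>j\<in>{1..<i}. of_bool (\<not> P j)) * max 0 (x i - \<theta>)) =
      (\<Sum>i\<in>{t}. (\<Prod>j\<in>{1..<i}. of_bool (\<not> P j)) * max 0 (x i - \<theta>))"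
  proof (rule sum.mono_neutral_right)
    show "\<forall>i\<in>{1..n} - {t}. (\<Prod>j\<in>{1..<i}. of_bool (\<not> P j)) * max 0 (x i - \<theta>) = 0"
    proof
      fix i assume i: "i \<in> {1..n} - {t}"
      show "(\<Prod>j\<in>{1..<i}. of_bool (\<not> P j)) * max 0 (x i - \<theta>) = 0"
      proof (cases "i < t")
        case True
        then show ?thesis using i t(3)[of i] below[of i] by simp
      next
        case False
        then have "t \<in> {1..<i}" using i t(1) by auto
        then have "(\<Prod>j\<in>{1..<i}. of_bool (\<not> P j) :: real) = 0"
          using t(2) by (intro prod_zero) auto
        then show ?thesis by simp
      qed
    qed
  qed (use t in auto)
  also have "\<dots> = x t - \<theta>"
  proof -
    have "(\<Prod>j\<in>{1..<t}. of_bool (\<not> P j) :: real) = 1" using t(3) by (intro prod.neutral) auto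
    then show ?thesis using above[OF t(1,2)] by simp
  qed
  finally have excess: "(\<Sum>i\<in>{1..n}. (\<Prod>j\<in>{1..<i}. of_bool (\<not> P j)) * max 0 (x i - \<theta>)) = x t - \<theta>" .
  have none: "(\<Prod>j\<in>{1..n}. of_bool (\<not> P j) :: real) = 0"
    using t by (intro prod_zero) auto
  have "x t \<le> reward \<gamma> n x t" unfolding reward_def using t(1) by (intro Max_ge) auto
  then show ?thesis unfolding excess none t_def[symmetric] by simp
next
  case False
  then have "first_time n P = n + 1"
    using first_time_le_iff[of n n P] first_time_range[of n P] by auto
  moreover have "(\<Sum>i\<in>{1..n}. (\<Prod>j\<in>{1..<i}. of_bool (\<not> P j)) * max 0 (x i - \<theta>)) = 0"
    using False below by (intro sum.neutral) auto
  moreover have "(\<Prod>j\<in>{1..n}. of_bool (\<not> P j) :: real) = 1"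
    using False by (intro prod.neutral) auto
  moreover have "\<gamma> * max_value n x \<le> reward \<gamma> n x (n + 1)"
  proof -
    have "max_value n x \<in> x ` {1..n}"
      unfolding max_value_def using \<open>1 \<le> n\<close> by (intro Max_in) auto
    then obtain i where "i \<in> {1..n}" "max_value n x = x i" by auto
    then show ?thesis unfolding reward_def by (intro Max_ge) auto
  qed
  ultimately show ?thesis by simp
qed

text \<open>The maximum exceeds \<open>\<theta>\<close> by at most the sum of all excesses. Without
  acceptance it is at most \<open>\<theta>\<close>, and there it is kept as it stands, for
  comparison with the \<open>\<gamma>\<close> part of the reward.\<close>

lemma max_value_le_excess:
  assumes "1 \<le> n"
    and above: "\<And>i. i \<in> {1..n} \<Longrightarrow> P i \<Longrightarrow> \<theta> \<le> x i"
    and below: "\<And>i. i \<in> {1..n} \<Longrightarrow> \<not> P i \<Longrightarrow> x i \<le> \<theta>"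
  shows "max_value n x \<le> (\<Prod>j\<in>{1..n}. of_bool (\<not> P j)) * max_value n x
      + (1 - (\<Prod>j\<in>{1..n}. of_bool (\<not> P j))) * \<theta> + (\<Sum>i\<in>{1..n}. max 0 (x i - \<theta>))" (is ?le)
    and "(\<Prod>j\<in>{1..n}. of_bool (\<not> P j)) * max_value n x \<le> (\<Prod>j\<in>{1..n}. of_bool (\<not> P j)) * \<theta>" (is ?le')
proof -
  have "max_value n x \<in> x ` {1..n}"
    unfolding max_value_def using \<open>1 \<le> n\<close> by (intro Max_in) auto
  then obtain i where i: "i \<in> {1..n}" "max_value n x = x i" by auto
  have "max 0 (x i - \<theta>) \<le> (\<Sum>i\<in>{1..n}. max 0 (x i - \<theta>))"
    using i(1) by (intro member_le_sum) auto
  then have *: "max_value n x \<le> \<theta> + (\<Sum>i\<in>{1..n}. max 0 (x i - \<theta>))" using i(2) by linarith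
  have "(\<Prod>j\<in>{1..n}. of_bool (\<not> P j) :: real) = of_bool (\<forall>j\<in>{1..n}. \<not> P j)"
    by (auto simp: of_bool_def intro: prod_zero)
  moreover have "0 \<le> (\<Sum>i\<in>{1..n}. max 0 (x i - \<theta>))" by (intro sum_nonneg) auto
  ultimately show ?le using * by auto
  show ?le' unfolding \<open>(\<Prod>j\<in>{1..n}. of_bool (\<not> P j) :: real) = of_bool (\<forall>j\<in>{1..n}. \<not> P j)\<close>
    using below i by auto
qed

text \<open>Pads a product over the first steps with ones to a product over all steps, the shape
  that \<open>integral_prod_sample\<close> handles.\<close>

lemma prod_prefix:
  fixes f :: "nat \<Rightarrow> real"
  assumes "i \<in> {1..n}"
  shows "(\<Prod>j\<in>{1..n}. if j < i then f j else if j = i then c else 1) = (\<Prod>j\<in>{1..<i}. f j) * c"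
proof -
  have "(\<Prod>j\<in>{1..n}. if j < i then f j else if j = i then c else 1) =
      (\<Prod>j\<in>insert i {1..<i}. if j < i then f j else if j = i then c else 1)"
    using assms by (intro prod.mono_neutral_right) auto
  also have "\<dots> = c * (\<Prod>j\<in>{1..<i}. f j)" by simp
  finally show ?thesis by (simp add: mult.commute)
qed

section \<open>Expected reward of rules that take the first accepted value\<close>

context iid_sample
begin

lemma integrable_reward:
  assumes T [measurable]: "T \<in> sample_space F n \<rightarrow>\<^sub>M count_space UNIV"
    and T_range: "\<And>\<omega>. \<omega> \<in> space (sample_space F n) \<Longrightarrow> T \<omega> \<in> {1..n+1}"
    and "integrable F (\<lambda>x. x)" "1 \<le> n" "0 \<le> \<gamma>" "\<gamma> \<le> 1"
  shows "integrable (sample_space F n) (\<lambda>\<omega>. reward \<gamma> n (val \<omega>) (T \<omega>))"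
proof (rule Bochner_Integration.integrable_bound)
  show "integrable (sample_space F n) (\<lambda>\<omega>. \<Sum>i\<in>{1..n}. \<bar>val \<omega> i\<bar>)"
    using integrable_val[OF assms(3)] by auto
  show "(\<lambda>\<omega>. reward \<gamma> n (val \<omega>) (T \<omega>)) \<in> borel_measurable (sample_space F n)"
    by (rule measurable_reward[OF T])
  show "AE \<omega> in sample_space F n. norm (reward \<gamma> n (val \<omega>) (T \<omega>)) \<le> norm (\<Sum>i\<in>{1..n}. \<bar>val \<omega> i\<bar>)"
  proof (rule AE_I2)
    fix \<omega> assume "\<omega> \<in> space (sample_space F n)"
    note T_\<omega> = T_range[OF this]
    define S where "S = (if T \<omega> \<le> n then {val \<omega> (T \<omega>)} else {}) \<union> (\<lambda>i. \<gamma> * val \<omega> i) ` {1..<T \<omega>}"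
    have "Max S \<in> S" unfolding S_def using T_\<omega> \<open>1 \<le> n\<close> by (intro Max_in) (auto split: if_splits)
    \<comment> \<open>Whatever the stopping time, the reward is one of the values times
      \<open>1\<close> or \<open>\<gamma>\<close>, hence dominated by the sum of absolute
      values.\<close>
    then obtain i c where i: "i \<in> {1..n}" "0 \<le> c" "c \<le> 1" "Max S = c * val \<omega> i"
    proof -
      assume *: "\<And>i c. i \<in> {1..n} \<Longrightarrow> 0 \<le> c \<Longrightarrow> c \<le> 1 \<Longrightarrow> Max S = c * val \<omega> i \<Longrightarrow> thesis"
      assume "Max S \<in> S"
      then consider "T \<omega> \<le> n" "Max S = val \<omega> (T \<omega>)" | i where "i \<in> {1..<T \<omega>}" "Max S = \<gamma> * val \<omega> i"
        unfolding S_def by (auto split: if_splits)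
      then show thesis
      proof cases
        case 1
        then show ?thesis using T_\<omega> by (intro *[of "T \<omega>" 1]) auto
      next
        case 2
        then show ?thesis using T_\<omega> assms(5,6) by (intro *[of i \<gamma>]) auto
      qed
    qed
    have "norm (Max S) \<le> \<bar>val \<omega> i\<bar>" using i(2-4) by (simp add: abs_mult mult_left_le_one_le)
    also have "\<dots> \<le> (\<Sum>i\<in>{1..n}. \<bar>val \<omega> i\<bar>)" using i(1) by (intro member_le_sum) auto
    finally show "norm (reward \<gamma> n (val \<omega>) (T \<omega>)) \<le> norm (\<Sum>i\<in>{1..n}. \<bar>val \<omega> i\<bar>)"
      by (simp add: reward_def S_def)
  qed
qed

lemma stopping_time_first_time:
  assumes [measurable]: "Measurable.pred (step_space F) acc"
  shows "stopping_time (history F n) (\<lambda>\<omega>. first_time n (\<lambda>i. acc (\<omega> i)))"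
proof
  fix t
  show "Measurable.pred (history F n t) (\<lambda>\<omega>. first_time n (\<lambda>i. acc (\<omega> i)) \<le> t)"
  proof (cases "t \<le> n")
    case True
    \<comment> \<open>Coordinates up to \<open>t\<close> can be read off the restriction that
      generates the history.\<close>
    have "(\<lambda>\<omega>. \<omega> i) \<in> history F n t \<rightarrow>\<^sub>M step_space F" if "i \<in> {1..t}" for i
    proof -
      have "(\<lambda>\<omega>. restrict \<omega> {1..min t n}) \<in> history F n t \<rightarrow>\<^sub>M Pi\<^sub>M {1..min t n} (\<lambda>_. step_space F)"
        unfolding history_def
        by (rule measurable_vimage_algebra1) (use measurable_space[OF measurable_restrict_history] in blast)
      then have "(\<lambda>\<omega>. restrict \<omega> {1..min t n} i) \<in> history F n t \<rightarrow>\<^sub>M step_space F"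
        by (rule measurable_compose[OF _ measurable_component_singleton]) (use that True in auto)
      then show ?thesis using that True by simp
    qed
    then have [measurable]: "Measurable.pred (history F n t) (\<lambda>\<omega>. acc (\<omega> i))" if "i \<in> {1..t}" for i
      using that by (intro measurable_compose[OF _ assms]) auto
    have "Measurable.pred (history F n t) (\<lambda>\<omega>. \<exists>i\<in>{1..t}. acc (\<omega> i))"
      by (intro pred_intros_finite) auto
    then show ?thesis using True by (simp add: first_time_le_iff)
  next
    case False
    \<comment> \<open>Past time \<open>n\<close> the event is certain, since
      \<open>first_time\<close> is at most \<open>n + 1\<close>.\<close>
    then have "first_time n P \<le> t" for P using first_time_range[of n P] by auto
    then show ?thesis by simp
  qed
qed

text \<open>Here \<open>q\<close> is the chance of rejecting one value and \<open>p = q ^ n\<close>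
  that of rejecting all. Integrating the pointwise bounds reduces the claim to an inequality in
  \<open>M0\<close>, \<open>\<theta>\<close> and \<open>D\<close>. It splits into a
  \<open>\<theta>\<close> part, settled by \<open>M0 \<le> p * \<theta>\<close>, and a
  \<open>D\<close> part, settled by the equation for \<open>p\<close>.\<close>

lemma expected_reward_first_time_ge:
  assumes acc [measurable]: "Measurable.pred (step_space F) acc"
    and above: "\<And>z. acc z \<Longrightarrow> \<theta> \<le> fst z" and below: "\<And>z. \<not> acc z \<Longrightarrow> fst z \<le> \<theta>"
    and int: "integrable F (\<lambda>x. x)" and n: "1 \<le> n" and \<gamma>: "0 \<le> \<gamma>" "\<gamma> \<le> 1"
    and p: "is_p_gamma \<gamma> p" and q: "0 < q" "q ^ n = p"
    and prob_acc: "measure (step_space F) {z. acc z} = 1 - q"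
  shows "(\<integral>\<omega>. reward \<gamma> n (val \<omega>) (first_time n (\<lambda>i. acc (\<omega> i))) \<partial>sample_space F n)
    \<ge> (1 - (1 - \<gamma>) * p) * expected_max F n"
proof -
  let ?T = "\<lambda>\<omega>. first_time n (\<lambda>i. acc (\<omega> i))"
  define rej where "rej z = (of_bool (\<not> acc z) :: real)" for z
  define excess where "excess z = max 0 (fst z - \<theta>)" for z :: "real \<times> real"
  define D where "D = (\<integral>z. excess z \<partial>step_space F)"
  have [measurable]: "rej \<in> borel_measurable (step_space F)"
    unfolding rej_def[abs_def] by measurable
  have int_rej: "integrable (step_space F) rej"
    by (rule step.integrable_const_bound[of _ 1]) (auto simp: rej_def)
  have int_excess: "integrable (step_space F) excess"
  proof -
    have "integrable F (\<lambda>x. max 0 (x - \<theta>))"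
      by (intro integrable_max Bochner_Integration.integrable_diff int integrable_const integrable_zero)
    then show ?thesis unfolding excess_def[abs_def]
      by (intro integral_fst_step(2)[of "\<lambda>x. max 0 (x - \<theta>)", THEN iffD2]) auto
  qed
  have rej_integral: "(\<integral>z. rej z \<partial>step_space F) = q"
  proof -
    have ev: "{z. acc z} \<in> sets (step_space F)" using acc by (simp add: pred_def)
    have "rej = indicator (space (step_space F) - {z. acc z})" by (auto simp: rej_def)
    then show ?thesis using ev step.prob_compl[OF ev] prob_acc by simp
  qed
  have D_nonneg: "0 \<le> D" unfolding D_def by (intro integral_nonneg_AE) (simp add: excess_def)
  let ?N = "\<lambda>\<omega>. \<Prod>j\<in>{1..n}. rej (\<omega> j)"
  have N: "integrable (sample_space F n) ?N" "(\<integral>\<omega>. ?N \<omega> \<partial>sample_space F n) = p"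
    using integral_prod_sample[of "\<lambda>_. rej"] int_rej rej_integral q by simp_all
  have prefix: "integrable (sample_space F n) (\<lambda>\<omega>. (\<Prod>j\<in>{1..<i}. rej (\<omega> j)) * excess (\<omega> i))"
    "(\<integral>\<omega>. (\<Prod>j\<in>{1..<i}. rej (\<omega> j)) * excess (\<omega> i) \<partial>sample_space F n) = q ^ (i - 1) * D"
    if i: "i \<in> {1..n}" for i
  proof -
    \<comment> \<open>Steps before \<open>i\<close> are rejected, step \<open>i\<close> contributes
      its excess and later steps are free; independence gives
      \<open>q ^ (i - 1) * D\<close>.\<close>
    define f where "f j = (if j < i then rej else if j = i then excess else (\<lambda>_. 1))" for j
    have int_f: "integrable (step_space F) (f j)" for j
      by (simp add: f_def int_rej int_excess)
    have E_f: "(\<integral>z. f j z \<partial>step_space F) = (if j < i then q else if j = i then D else 1)" for j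
      using step.prob_space by (simp add: f_def rej_integral D_def)
    have prod_f: "(\<Prod>j\<in>{1..<i}. rej (\<omega> j)) * excess (\<omega> i) = (\<Prod>j\<in>{1..n}. f j (\<omega> j))" for \<omega>
      by (subst prod_prefix[OF i, symmetric]) (auto simp: f_def intro!: prod.cong)
    show "integrable (sample_space F n) (\<lambda>\<omega>. (\<Prod>j\<in>{1..<i}. rej (\<omega> j)) * excess (\<omega> i))"
      unfolding prod_f by (rule integral_prod_sample(1)[OF int_f])
    show "(\<integral>\<omega>. (\<Prod>j\<in>{1..<i}. rej (\<omega> j)) * excess (\<omega> i) \<partial>sample_space F n) = q ^ (i - 1) * D"
      unfolding prod_f integral_prod_sample(2)[OF int_f] E_f prod_prefix[OF i] by simp
  qed
  have int_max: "integrable (sample_space F n) (\<lambda>\<omega>. max_value n (val \<omega>))"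
    by (rule integrable_max_value[OF int n])
  have N_meas [measurable]: "?N \<in> borel_measurable (sample_space F n)" using N(1) by auto
  have N_01: "0 \<le> ?N \<omega>" "?N \<omega> \<le> 1" for \<omega>
    by (auto simp: rej_def intro!: prod_nonneg prod_le_1)
  have int_Nmax: "integrable (sample_space F n) (\<lambda>\<omega>. ?N \<omega> * max_value n (val \<omega>))"
  proof (rule Bochner_Integration.integrable_bound[OF int_max])
    show "(\<lambda>\<omega>. ?N \<omega> * max_value n (val \<omega>)) \<in> borel_measurable (sample_space F n)"
      using int_max by measurable
    show "AE \<omega> in sample_space F n. norm (?N \<omega> * max_value n (val \<omega>)) \<le> norm (max_value n (val \<omega>))"
      using N_01 by (intro AE_I2) (simp add: abs_mult mult_left_le_one_le del: prod.cl_ivl_Suc)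
  qed
  define M0 where "M0 = (\<integral>\<omega>. ?N \<omega> * max_value n (val \<omega>) \<partial>sample_space F n)"
  have sample_excess: "integrable (sample_space F n) (\<lambda>\<omega>. excess (\<omega> i))"
    "(\<integral>\<omega>. excess (\<omega> i) \<partial>sample_space F n) = D" if "i \<in> {1..n}" for i
    using integral_component[OF int_excess that] by (simp_all add: D_def)
  have above': "acc (\<omega> i) \<Longrightarrow> \<theta> \<le> val \<omega> i" and below': "\<not> acc (\<omega> i) \<Longrightarrow> val \<omega> i \<le> \<theta>" for \<omega> i
    using above below by (auto simp: val_def)
  define lower where "lower \<omega> = (1 - ?N \<omega>) * \<theta> + (\<Sum>i\<in>{1..n}. (\<Prod>j\<in>{1..<i}. rej (\<omega> j)) * excess (\<omega> i))
    + \<gamma> * (?N \<omega> * max_value n (val \<omega>))" for \<omega>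
  define upper where "upper \<omega> = ?N \<omega> * max_value n (val \<omega>) + (1 - ?N \<omega>) * \<theta>
    + (\<Sum>i\<in>{1..n}. excess (\<omega> i))" for \<omega>
  have one: "has_bochner_integral (sample_space F n) (\<lambda>_. 1) (1 :: real)"
    by (simp add: has_bochner_integral_iff sample.prob_space)
  have N': "has_bochner_integral (sample_space F n) ?N p"
    and Nmax': "has_bochner_integral (sample_space F n) (\<lambda>\<omega>. ?N \<omega> * max_value n (val \<omega>)) M0"
    unfolding has_bochner_integral_iff M0_def using N int_Nmax by blast+
  have prefix': "has_bochner_integral (sample_space F n)
      (\<lambda>\<omega>. (\<Prod>j\<in>{1..<i}. rej (\<omega> j)) * excess (\<omega> i)) (q ^ (i - 1) * D)"
    and excess': "has_bochner_integral (sample_space F n) (\<lambda>\<omega>. excess (\<omega> i)) D" if "i \<in> {1..n}" for i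
    unfolding has_bochner_integral_iff using prefix[OF that] sample_excess[OF that] by blast+
  have lower: "has_bochner_integral (sample_space F n) lower
      ((1 - p) * \<theta> + (\<Sum>i\<in>{1..n}. q ^ (i - 1) * D) + \<gamma> * M0)"
    unfolding lower_def
    by (intro has_bochner_integral_add has_bochner_integral_sum has_bochner_integral_mult_left
        has_bochner_integral_mult_right has_bochner_integral_diff one N' Nmax' prefix')
  have upper: "has_bochner_integral (sample_space F n) upper (M0 + (1 - p) * \<theta> + (\<Sum>i\<in>{1..n}. D))"
    unfolding upper_def
    by (intro has_bochner_integral_add has_bochner_integral_sum has_bochner_integral_mult_left
        has_bochner_integral_diff one N' Nmax' excess')
  have "integral\<^sup>L (sample_space F n) lower
    \<le> (\<integral>\<omega>. reward \<gamma> n (val \<omega>) (?T \<omega>) \<partial>sample_space F n)"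
  proof (rule integral_mono)
    show "integrable (sample_space F n) lower" using lower by (simp add: has_bochner_integral_iff)
    show "integrable (sample_space F n) (\<lambda>\<omega>. reward \<gamma> n (val \<omega>) (?T \<omega>))"
      using int n \<gamma> first_time_range
      by (intro integrable_reward measurable_stopping_time_history stopping_time_first_time acc) auto
    show "lower \<omega> \<le> reward \<gamma> n (val \<omega>) (?T \<omega>)" for \<omega>
      unfolding lower_def rej_def excess_def val_def[symmetric]
      by (rule reward_first_time_ge[OF n above' below'])
  qed
  then have reward_ge: "(1 - p) * \<theta> + (\<Sum>i\<in>{1..n}. q ^ (i - 1)) * D + \<gamma> * M0
      \<le> (\<integral>\<omega>. reward \<gamma> n (val \<omega>) (?T \<omega>) \<partial>sample_space F n)"
    using has_bochner_integral_integral_eq[OF lower] by (simp add: sum_distrib_right)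
  have "expected_max F n \<le> integral\<^sup>L (sample_space F n) upper"
    unfolding expected_max_def
  proof (rule integral_mono[OF int_max])
    show "integrable (sample_space F n) upper" using upper by (simp add: has_bochner_integral_iff)
    show "max_value n (val \<omega>) \<le> upper \<omega>" for \<omega>
      unfolding upper_def rej_def excess_def val_def[symmetric]
      by (rule max_value_le_excess(1)[OF n above' below'])
  qed
  then have max_le: "expected_max F n \<le> M0 + (1 - p) * \<theta> + n * D"
    using has_bochner_integral_integral_eq[OF upper] by simp
  have M0_le: "M0 \<le> p * \<theta>"
  proof -
    have N\<theta>: "has_bochner_integral (sample_space F n) (\<lambda>\<omega>. ?N \<omega> * \<theta>) (p * \<theta>)"
      by (rule has_bochner_integral_mult_left[OF N'])
    have "M0 \<le> (\<integral>\<omega>. ?N \<omega> * \<theta> \<partial>sample_space F n)"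
      unfolding M0_def
    proof (rule integral_mono[OF int_Nmax])
      show "integrable (sample_space F n) (\<lambda>\<omega>. ?N \<omega> * \<theta>)"
        using N\<theta> unfolding has_bochner_integral_iff by blast
      show "?N \<omega> * max_value n (val \<omega>) \<le> ?N \<omega> * \<theta>" for \<omega>
        unfolding rej_def by (rule max_value_le_excess(2)[OF n above' below'])
    qed
    then show ?thesis unfolding has_bochner_integral_integral_eq[OF N\<theta>] .
  qed
  define \<alpha> where "\<alpha> = 1 - (1 - \<gamma>) * p"
  have p': "0 < p" "p < 1" "\<alpha> = (1 - p) / (- ln p)" using p by (auto simp: is_p_gamma_def \<alpha>_def)
  have "0 \<le> \<alpha>"
  proof -
    have "(1 - \<gamma>) * p \<le> 1" using p' \<gamma> by (intro mult_le_one) auto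
    then show ?thesis by (simp add: \<alpha>_def)
  qed
  have "q < 1"
  proof (rule ccontr)
    assume "\<not> q < 1"
    then have "1 \<le> q ^ n" by (intro one_le_power) auto
    then show False using q p' by simp
  qed
  \<comment> \<open>The geometric sum is \<open>(1 - p) / (1 - q)\<close>. From
    \<open>ln q \<le> q - 1\<close> follows \<open>n * (1 - q) \<le> - ln p\<close>, and
    \<open>\<alpha> * (- ln p) = 1 - p\<close> is the equation for \<open>p\<close>.\<close>
  have sum_q: "\<alpha> * n \<le> (\<Sum>i\<in>{1..n}. q ^ (i - 1))"
  proof -
    have "(\<Sum>i\<in>{1..n}. q ^ (i - 1)) = (\<Sum>i<n. q ^ i)"
      by (rule sum.reindex_bij_witness[of _ Suc "\<lambda>i. i - 1"]) auto
    also have "\<dots> = (1 - p) / (1 - q)"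
      using \<open>q < 1\<close> q by (simp add: sum_gp_strict)
    finally have sum_eq: "(\<Sum>i\<in>{1..n}. q ^ (i - 1)) = (1 - p) / (1 - q)" .
    have "ln p = n * ln q" using q by (auto simp: ln_realpow)
    moreover have "ln q \<le> q - 1" using q by (intro ln_le_minus_one) auto
    ultimately have "n * (1 - q) \<le> - ln p"
      using mult_left_mono[of "ln q" "q - 1" "real n"] by (simp add: algebra_simps)
    moreover have "- ln p > 0" using p' by simp
    ultimately have "\<alpha> * (n * (1 - q)) \<le> \<alpha> * (- ln p)"
      using \<open>0 \<le> \<alpha>\<close> by (intro mult_left_mono)
    also have "\<dots> = 1 - p" using p' by (simp add: p'(3))
    finally show ?thesis unfolding sum_eq using \<open>q < 1\<close> by (simp add: field_simps)
  qed
  have "\<alpha> * expected_max F n \<le> \<alpha> * (M0 + (1 - p) * \<theta> + n * D)"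
    using max_le \<open>0 \<le> \<alpha>\<close> by (rule mult_left_mono)
  also have "\<dots> = \<alpha> * (M0 + (1 - p) * \<theta>) + \<alpha> * n * D" by (simp add: algebra_simps)
  also have "\<dots> \<le> (\<gamma> * M0 + (1 - p) * \<theta>) + (\<Sum>i\<in>{1..n}. q ^ (i - 1)) * D"
  proof (rule add_mono)
    \<comment> \<open>The difference of the two sides factors, with \<open>p * \<theta> - M0\<close>
      as the factor that \<open>M0_le\<close> makes nonnegative.\<close>
    have "0 \<le> (1 - \<gamma>) * (1 - p) * (p * \<theta> - M0)" using \<gamma> p' M0_le by (intro mult_nonneg_nonneg) auto
    also have "\<dots> = \<gamma> * M0 + (1 - p) * \<theta> - \<alpha> * (M0 + (1 - p) * \<theta>)"
      by (simp add: \<alpha>_def algebra_simps)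
    finally show "\<alpha> * (M0 + (1 - p) * \<theta>) \<le> \<gamma> * M0 + (1 - p) * \<theta>" by simp
    show "\<alpha> * n * D \<le> (\<Sum>i\<in>{1..n}. q ^ (i - 1)) * D"
      by (rule mult_right_mono[OF sum_q D_nonneg])
  qed
  finally show ?thesis using reward_ge by (simp add: \<alpha>_def)
qed

end

text \<open>At the \<open>(1 - a)\<close>-quantile \<open>\<theta>\<close> the mass strictly above
  is at most \<open>a\<close>, and together with the atom at \<open>\<theta>\<close> it is at least
  \<open>a\<close>. Accepting the fraction \<open>r\<close> of the atom hits \<open>a\<close>
  exactly.\<close>

lemma exists_randomized_quantile:
  fixes F :: "real measure"
  assumes "prob_space F" "sets F = sets borel" and a: "0 < a" "a < 1"
  obtains \<theta> r where "0 \<le> r" "r \<le> 1" "measure F {\<theta><..} + measure F {\<theta>} * r = a"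
proof -
  interpret real_distribution F
    using assms by (simp add: real_distribution_def real_distribution_axioms_def)
  interpret cdf_distribution F ..
  define \<theta> where "\<theta> = Inf {x. 1 - a \<le> cdf F x}"
  have inv: "1 - a \<le> cdf F x \<longleftrightarrow> \<theta> \<le> x" for x
    unfolding \<theta>_def using a by (intro pseudoinverse) auto
  have split: "cdf F \<theta> = measure F {..<\<theta>} + measure F {\<theta>}"
    unfolding cdf_def ivl_disj_un(2)[symmetric] by (subst finite_measure_Union) auto
  have compl: "measure F {\<theta><..} = 1 - cdf F \<theta>"
  proof -
    have eq: "space F - {..\<theta>} = {\<theta><..}" by auto
    have "prob (space F - {..\<theta>}) = 1 - prob {..\<theta>}" by (rule prob_compl) simp
    then show ?thesis unfolding eq cdf_def .
  qed
  \<comment> \<open>The mass strictly below \<open>\<theta>\<close> is the left limit of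
    \<open>cdf F\<close>, which stays under \<open>1 - a\<close> there by the choice of
    \<open>\<theta>\<close>.\<close>
  have le: "measure F {..<\<theta>} \<le> 1 - a"
  proof (rule tendsto_upperbound[OF cdf_at_left])
    have "cdf F x \<le> 1 - a" if "x < \<theta>" for x using inv[of x] that by linarith
    then show "\<forall>\<^sub>F x in at_left \<theta>. cdf F x \<le> 1 - a"
      unfolding eventually_at_filter by simp
  qed simp
  have ge: "1 - a \<le> cdf F \<theta>" using inv by simp
  show thesis
  proof (cases "measure F {\<theta>} = 0")
    case True
    then have "measure F {\<theta><..} + measure F {\<theta>} * 0 = a" using split compl le ge by simp
    then show ?thesis by (intro that[of 0 \<theta>]) auto
  next
    case False
    then have pos: "0 < measure F {\<theta>}" using measure_nonneg[of F "{\<theta>}"] by linarith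
    define r where "r = (a - measure F {\<theta><..}) / measure F {\<theta>}"
    have "0 \<le> r" "r \<le> 1" unfolding r_def using pos split compl le ge by (auto simp: field_simps)
    moreover have "measure F {\<theta><..} + measure F {\<theta>} * r = a" unfolding r_def using pos by simp
    ultimately show ?thesis by (intro that[of r \<theta>])
  qed
qed

section \<open>Acceptance probabilities and the threshold rules\<close>

lemma (in iid_sample) measure_step_Times:
  assumes "A \<in> sets borel" "B \<in> sets borel"
  shows "measure (step_space F) (A \<times> B) = measure F A * measure (uniform_measure lborel {0..1}) B"
proof -
  interpret C: prob_space "uniform_measure lborel {0..1::real}" by (rule prob_space_coin)
  show ?thesis unfolding step_space_def measure_def using assms
    by (subst C.emeasure_pair_measure_Times) (auto simp: sets_F enn2real_mult)
qed

lemma measure_coin_less: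
  assumes "0 \<le> r" "r \<le> (1::real)"
  shows "measure (uniform_measure lborel {0..1}) {..<r} = r"
proof -
  have "{0..1} \<inter> {..<r} = {0..<r}" using assms by auto
  then show ?thesis using assms by (simp add: measure_uniform_measure)
qed

lemma (in iid_sample) measure_step_above:
  "measure (step_space F) {z. \<theta> < fst z} = measure F {\<theta><..}"
proof -
  have "{z :: real \<times> real. \<theta> < fst z} = {\<theta><..} \<times> UNIV" by auto
  then show ?thesis using prob_space.prob_space[OF prob_space_coin] by (simp add: measure_step_Times)
qed

lemma (in iid_sample) measure_step_above_tie:
  assumes "0 \<le> r" "r \<le> 1"
  shows "measure (step_space F) {z. \<theta> < fst z \<or> \<theta> = fst z \<and> snd z < r} =
    measure F {\<theta><..} + measure F {\<theta>} * r"
proof -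
  have "{z :: real \<times> real. \<theta> < fst z \<or> \<theta> = fst z \<and> snd z < r} = {z. \<theta> < fst z} \<union> {\<theta>} \<times> {..<r}"
    by auto
  also have "measure (step_space F) \<dots> = measure (step_space F) {z. \<theta> < fst z} + measure (step_space F) ({\<theta>} \<times> {..<r})"
  proof (rule step.finite_measure_Union)
    have "{z :: real \<times> real. \<theta> < fst z} = {\<theta><..} \<times> UNIV" by auto
    then show "{z. \<theta> < fst z} \<in> sets (step_space F)" by (simp add: sets_step)
  qed (auto simp: sets_step)
  finally show ?thesis
    by (simp add: measure_step_Times measure_coin_less[OF assms] measure_step_above)
qed

lemma online_first_time:
  assumes "\<And>F n. (F, n) \<in> iid_instances \<Longrightarrow> Measurable.pred (step_space F) (acc F n)"
    and "\<And>F n \<omega>. A F n \<omega> = first_time n (\<lambda>i. acc F n (\<omega> i))"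
  shows "online_algorithm A"
  unfolding online_algorithm_def
proof (clarify, intro conjI ballI)
  fix F n assume "(F, n) \<in> iid_instances"
  then interpret iid_sample F n by (rule iid_sample_instance)
  have "A F n = (\<lambda>\<omega>. first_time n (\<lambda>i. acc F n (\<omega> i)))" by (rule ext) (rule assms(2))
  then show "stopping_time (history F n) (A F n)"
    using stopping_time_first_time[OF assms(1)[OF \<open>(F, n) \<in> iid_instances\<close>]] by simp
  show "A F n \<omega> \<in> {1..n + 1}" for \<omega> unfolding assms(2) by (rule first_time_range)
qed

lemma measurable_pred_threshold:
  assumes "(F, n) \<in> iid_instances"
  shows "Measurable.pred (step_space F) (\<lambda>z. (\<theta>::ereal) < ereal (fst z))"
    and "Measurable.pred (step_space F) (\<lambda>z. \<theta> < ereal (fst z) \<or> \<theta> = ereal (fst z) \<and> snd z < r)"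
proof -
  interpret iid_sample F n using assms by (rule iid_sample_instance)
  show "Measurable.pred (step_space F) (\<lambda>z. (\<theta>::ereal) < ereal (fst z))" by measurable
  show "Measurable.pred (step_space F) (\<lambda>z. \<theta> < ereal (fst z) \<or> \<theta> = ereal (fst z) \<and> snd z < r)" by measurable
qed

lemma online_single_threshold: "online_algorithm (single_threshold \<theta>)"
  by (rule online_first_time[where acc = "\<lambda>F n z. \<theta> F n < ereal (fst z)"])
    (auto simp: single_threshold_def val_def intro: measurable_pred_threshold)

lemma online_single_threshold_tie: "online_algorithm (single_threshold_tie \<theta> r)"
  by (rule online_first_time[where acc = "\<lambda>F n z. \<theta> F n < ereal (fst z) \<or> \<theta> F n = ereal (fst z) \<and> snd z < r F n"])
    (auto simp: single_threshold_tie_def val_def coin_def intro: measurable_pred_threshold)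

text \<open>The real infimum in \<open>competitive_ratio_ge\<close> has to range over a nonempty
  set. For a single value uniform on \<open>[1, 2]\<close> the maximum is at least 1, hence positive
  in mean.\<close>

lemma continuous_instances_nonempty: "continuous_instances \<noteq> {}"
proof -
  define F where "F = uniform_measure lborel {1..2::real}"
  have F: "prob_space F" "sets F = sets borel" unfolding F_def
    by (auto intro!: prob_space_uniform_measure)
  interpret iid_sample F 1 using F by (simp add: iid_sample_def iid_sample_axioms_def)
  have AE_F: "AE x in F. x \<in> {1..2}" unfolding F_def by (intro AE_uniform_measureI) auto
  have int: "integrable F (\<lambda>x. x)"
    by (rule integrable_const_bound[of _ 2]) (use AE_F in \<open>auto elim: eventually_mono\<close>)
  have "1 = (\<integral>\<omega>. (1::real) \<partial>sample_space F 1)" using sample.prob_space by simp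
  also have "\<dots> \<le> expected_max F 1" unfolding expected_max_def
  proof (rule integral_mono_AE[OF _ integrable_max_value[OF int]])
    show "AE \<omega> in sample_space F 1. 1 \<le> max_value 1 (val \<omega>)"
      using AE_val[OF AE_F, of 1] by (simp add: max_value_def)
    show "integrable (sample_space F 1) (\<lambda>_. 1 :: real)" by (rule sample.integrable_const)
  qed simp
  finally have "0 < expected_max F 1" by simp
  moreover have "measure F {x} = 0" for x
    unfolding F_def by (cases "x \<in> {1..2}") (simp_all add: measure_uniform_measure)
  moreover have "AE x in F. 0 \<le> x" using AE_F by eventually_elim simp
  ultimately have "(F, 1) \<in> continuous_instances"
    unfolding continuous_instances_def iid_instances_def using F int by simp
  then show ?thesis by blast
qed

lemma competitive_ratio_ge:
  assumes "I \<noteq> {}" "I \<subseteq> iid_instances"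
    and "\<And>F n. (F, n) \<in> I \<Longrightarrow> c * expected_max F n \<le> expected_reward \<gamma> A F n"
  shows "c \<le> competitive_ratio \<gamma> I A"
  unfolding competitive_ratio_def
proof (rule cINF_greatest[OF \<open>I \<noteq> {}\<close>], clarify)
  fix F n assume "(F, n) \<in> I"
  then show "c \<le> expected_reward \<gamma> A F n / expected_max F n"
    using assms(2) assms(3)[of F n] by (auto simp: iid_instances_def pos_le_divide_eq)
qed

text \<open>The threshold is the randomized quantile that rejects one value with probability
  \<open>root n p\<close>, so that all are rejected with probability exactly \<open>p\<close>. The
  same \<open>\<theta>\<close> serves continuous instances, where the atom at
  \<open>\<theta>\<close> has measure 0.\<close>

lemma exists_good_threshold:
  fixes \<gamma> :: real
  assumes \<gamma>: "0 \<le> \<gamma>" "\<gamma> < 1"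
  obtains \<theta> :: "real measure \<Rightarrow> nat \<Rightarrow> real" and r where
    "\<And>F n. 0 \<le> r F n \<and> r F n \<le> 1"
    "\<And>F n. (F, n) \<in> iid_instances \<Longrightarrow>
      (1 - (1 - \<gamma>) * p_gamma \<gamma>) * expected_max F n
        \<le> expected_reward \<gamma> (single_threshold_tie (\<lambda>F n. ereal (\<theta> F n)) r) F n"
    "\<And>F n. (F, n) \<in> continuous_instances \<Longrightarrow>
      (1 - (1 - \<gamma>) * p_gamma \<gamma>) * expected_max F n
        \<le> expected_reward \<gamma> (single_threshold (\<lambda>F n. ereal (\<theta> F n))) F n"
proof -
  have p: "is_p_gamma \<gamma> (p_gamma \<gamma>)"
    unfolding p_gamma_def by (rule theI'[OF exists_unique_p_gamma[OF \<gamma>]])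
  then have p01: "0 < p_gamma \<gamma>" "p_gamma \<gamma> < 1" by (auto simp: is_p_gamma_def)
  define q where "q n = root n (p_gamma \<gamma>)" for n
  have q: "0 < q n" "q n < 1" "q n ^ n = p_gamma \<gamma>" if "1 \<le> n" for n
    using that p01 by (auto simp: q_def)
  have "\<exists>\<theta> r. 0 \<le> r \<and> r \<le> 1 \<and> ((F, n) \<in> iid_instances \<longrightarrow>
      measure F {\<theta><..} + measure F {\<theta>} * r = 1 - q n)" for F n
  proof (cases "(F, n) \<in> iid_instances")
    case True
    then have F: "prob_space F" "sets F = sets borel" and "1 \<le> n" by (auto simp: iid_instances_def)
    then have "0 < 1 - q n" "1 - q n < 1" using q[of n] by auto
    from exists_randomized_quantile[OF F this] show ?thesis by blast
  qed (intro exI[of _ 0], simp)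
  then have "\<forall>F n. \<exists>\<theta> r. 0 \<le> r \<and> r \<le> 1 \<and> ((F, n) \<in> iid_instances \<longrightarrow>
      measure F {\<theta><..} + measure F {\<theta>} * r = 1 - q n)" by blast
  then obtain \<theta> r where *: "\<forall>F n. 0 \<le> r F n \<and> r F n \<le> 1 \<and> ((F, n) \<in> iid_instances \<longrightarrow>
      measure F {\<theta> F n<..} + measure F {\<theta> F n} * r F n = 1 - q n)"
    unfolding choice_iff by blast
  then have r: "0 \<le> r F n \<and> r F n \<le> 1"
    and quantile: "(F, n) \<in> iid_instances \<Longrightarrow> measure F {\<theta> F n<..} + measure F {\<theta> F n} * r F n = 1 - q n" for F n
    by blast+
  show thesis
  proof (rule that[OF r])
    fix F n assume Fn: "(F, n) \<in> iid_instances"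
    interpret iid_sample F n using Fn by (rule iid_sample_instance)
    have n: "1 \<le> n" and int: "integrable F (\<lambda>x. x)" using Fn by (auto simp: iid_instances_def)
    define acc where "acc z \<longleftrightarrow> \<theta> F n < fst z \<or> \<theta> F n = fst z \<and> snd z < r F n" for z :: "real \<times> real"
    have "Measurable.pred (step_space F) acc" unfolding acc_def by measurable
    moreover have "measure (step_space F) {z. acc z} = 1 - q n"
      unfolding acc_def using r[of F n] quantile[OF Fn] by (simp add: measure_step_above_tie)
    ultimately have "(1 - (1 - \<gamma>) * p_gamma \<gamma>) * expected_max F n
        \<le> (\<integral>\<omega>. reward \<gamma> n (val \<omega>) (first_time n (\<lambda>i. acc (\<omega> i))) \<partial>sample_space F n)"
      using \<gamma> by (intro expected_reward_first_time_ge[OF _ _ _ int n _ _ p q(1,3)[OF n], where \<theta> = "\<theta> F n"])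
        (auto simp: acc_def)
    then show "(1 - (1 - \<gamma>) * p_gamma \<gamma>) * expected_max F n
        \<le> expected_reward \<gamma> (single_threshold_tie (\<lambda>F n. ereal (\<theta> F n)) r) F n"
      by (simp add: expected_reward_def single_threshold_tie_def acc_def val_def coin_def)
  next
    fix F n assume "(F, n) \<in> continuous_instances"
    then have Fn: "(F, n) \<in> iid_instances" and "measure F {\<theta> F n} = 0"
      by (auto simp: continuous_instances_def)
    interpret iid_sample F n using Fn by (rule iid_sample_instance)
    have n: "1 \<le> n" and int: "integrable F (\<lambda>x. x)" using Fn by (auto simp: iid_instances_def)
    have "Measurable.pred (step_space F) (\<lambda>z. \<theta> F n < fst z)" by measurable
    moreover have "measure (step_space F) {z. \<theta> F n < fst z} = 1 - q n"
      using quantile[OF Fn] \<open>measure F {\<theta> F n} = 0\<close> by (simp add: measure_step_above)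
    ultimately have "(1 - (1 - \<gamma>) * p_gamma \<gamma>) * expected_max F n
        \<le> (\<integral>\<omega>. reward \<gamma> n (val \<omega>) (first_time n (\<lambda>i. \<theta> F n < fst (\<omega> i))) \<partial>sample_space F n)"
      using \<gamma> by (intro expected_reward_first_time_ge[OF _ _ _ int n _ _ p q(1,3)[OF n], where \<theta> = "\<theta> F n"]) auto
    then show "(1 - (1 - \<gamma>) * p_gamma \<gamma>) * expected_max F n
        \<le> expected_reward \<gamma> (single_threshold (\<lambda>F n. ereal (\<theta> F n))) F n"
      by (simp add: expected_reward_def single_threshold_def val_def)
  qed
qed

text \<open>For \<open>\<gamma> = 1\<close> past values keep their full worth, so waiting to the end
  collects the maximum. This covers the case in which \<open>p_gamma\<close> is unspecified.\<close>

lemma expected_reward_never_stop: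
  assumes "\<And>\<omega>. A F n \<omega> = n + 1"
  shows "expected_reward 1 A F n = expected_max F n"
proof -
  have "reward 1 n x (n + 1) = max_value n x" for x
    by (simp add: reward_def max_value_def atLeastLessThanSuc_atLeastAtMost)
  then show ?thesis by (simp only: expected_reward_def expected_max_def assms)
qed

theorem theorem4:
  fixes \<gamma> :: real
  assumes "0 \<le> \<gamma>" and "\<gamma> \<le> 1"
  shows "(\<forall>A. online_algorithm A \<longrightarrow> competitive_ratio \<gamma> iid_instances A \<le> U \<gamma>)
    \<and> strict_mono_on {0..1} U
    \<and> U 0 = (4 - ln 3) / (2 * (2 - 1 / exp 2)) \<and> \<bar>U 0 - 0.778\<bar> < 0.0005
    \<and> U 1 = 1
    \<and> (\<gamma> < 1 \<longrightarrow> (\<exists>!p. is_p_gamma \<gamma> p))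
    \<and> (\<exists>\<theta>. (\<gamma> < 1 \<longrightarrow> (\<forall>F n. \<bar>\<theta> F n\<bar> \<noteq> \<infinity>))
        \<and> online_algorithm (single_threshold \<theta>)
        \<and> competitive_ratio \<gamma> continuous_instances (single_threshold \<theta>) \<ge> 1 - (1 - \<gamma>) * p_gamma \<gamma>
        \<and> (\<exists>r. (\<forall>F n. 0 \<le> r F n \<and> r F n \<le> 1)
            \<and> online_algorithm (single_threshold_tie \<theta> r)
            \<and> competitive_ratio \<gamma> iid_instances (single_threshold_tie \<theta> r) \<ge> 1 - (1 - \<gamma>) * p_gamma \<gamma>))"
    (is "?upper \<and> ?mono \<and> ?U0 \<and> ?approx \<and> ?U1 \<and> ?ex1 \<and> ?lower")
proof (intro conjI)
  show ?upper using competitive_ratio_le_U[OF assms] by blast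
  show ?mono by (rule strict_mono_on_U)
  show ?U0 by (rule U_0)
  show ?approx by (rule U_0_approx)
  show ?U1 by (simp add: U_def)
  show ?ex1 using exists_unique_p_gamma[OF assms(1)] by blast
  have sub: "continuous_instances \<subseteq> iid_instances" by (auto simp: continuous_instances_def)
  then have ne: "iid_instances \<noteq> {}" using continuous_instances_nonempty by blast
  show ?lower
  proof (cases "\<gamma> < 1")
    case True
    obtain \<theta> r where
      r: "\<And>F n. 0 \<le> r F n \<and> r F n \<le> 1" and
      tie: "\<And>F n. (F, n) \<in> iid_instances \<Longrightarrow> (1 - (1 - \<gamma>) * p_gamma \<gamma>) * expected_max F n
        \<le> expected_reward \<gamma> (single_threshold_tie (\<lambda>F n. ereal (\<theta> F n)) r) F n" and
      cont: "\<And>F n. (F, n) \<in> continuous_instances \<Longrightarrow> (1 - (1 - \<gamma>) * p_gamma \<gamma>) * expected_max F n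
        \<le> expected_reward \<gamma> (single_threshold (\<lambda>F n. ereal (\<theta> F n))) F n"
      by (rule exists_good_threshold[OF assms(1) True]) blast
    show ?thesis
    proof (intro exI[of _ "\<lambda>F n. ereal (\<theta> F n)"] conjI exI[of _ r] impI allI)
      show "1 - (1 - \<gamma>) * p_gamma \<gamma> \<le> competitive_ratio \<gamma> continuous_instances (single_threshold (\<lambda>F n. ereal (\<theta> F n)))"
        by (rule competitive_ratio_ge[OF continuous_instances_nonempty sub cont])
      show "1 - (1 - \<gamma>) * p_gamma \<gamma> \<le> competitive_ratio \<gamma> iid_instances (single_threshold_tie (\<lambda>F n. ereal (\<theta> F n)) r)"
        by (rule competitive_ratio_ge[OF ne subset_refl tie])
    qed (use r in \<open>auto intro: online_single_threshold online_single_threshold_tie\<close>)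
  next
    case False
    \<comment> \<open>The required ratio is now 1, and the threshold \<open>\<infinity>\<close>
      attains it by never stopping.\<close>
    then have [simp]: "\<gamma> = 1" using assms by simp
    have never: "first_time n (\<lambda>_. False) = n + 1" for n
      using first_time_le_iff[of n n "\<lambda>_. False"] first_time_range[of n "\<lambda>_. False"] by auto
    have eq: "expected_reward 1 (single_threshold (\<lambda>_ _. \<infinity>)) F n = expected_max F n"
      "expected_reward 1 (single_threshold_tie (\<lambda>_ _. \<infinity>) (\<lambda>_ _. 0)) F n = expected_max F n" for F n
      by (rule expected_reward_never_stop, simp add: single_threshold_def single_threshold_tie_def never)+
    show ?thesis
    proof (intro exI[of _ "\<lambda>_ _. \<infinity>"] conjI exI[of _ "\<lambda>_ _. 0"] impI allI)
      show "1 - (1 - \<gamma>) * p_gamma \<gamma> \<le> competitive_ratio \<gamma> continuous_instances (single_threshold (\<lambda>_ _. \<infinity>))"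
        by (rule competitive_ratio_ge[OF continuous_instances_nonempty sub]) (simp add: eq)
      show "1 - (1 - \<gamma>) * p_gamma \<gamma> \<le> competitive_ratio \<gamma> iid_instances (single_threshold_tie (\<lambda>_ _. \<infinity>) (\<lambda>_ _. 0))"
        by (rule competitive_ratio_ge[OF ne subset_refl]) (simp add: eq)
    qed (auto intro: online_single_threshold online_single_threshold_tie)
  qed
qed

end
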